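(* Let $A$ be an artin algebra and $n\ge2$. Any indecomposable complex in $\mathbf{C}_{[0,n]}(\mathrm{proj}\,A)$ or in $\mathbf{C}_{n+1}(\mathrm{proj}\,A)$ is a shift or an enlargement (left or right, respectively) of an indecomposable complex in $\mathbf{C}_n(\mathrm{proj}\,A)$.
   Context: $A$ is an artin algebra and $\mathrm{proj}\,A$ is the category of finitely generated projective $A$-modules. For integers $m<n$, $\mathbf{C}_{[m,n]}(\mathrm{proj}\,A)$ is the full subcategory of the category of bounded complexes (differentials raising degree by one) of finitely generated $A$-modules whose objects are the complexes $X=(X^i,d^i)$ with $X^i\in\mathrm{proj}\,A$ and $X^i=0$ for $i\notin\{m,\dots,n\}$; $\mathbf{C}_n(\mathrm{proj}\,A)=\mathbf{C}_{[1,n]}(\mathrm{proj}\,A)$ for $n\ge2$. A shift of a complex $X$ is a complex $X[k]$, $k\in\mathbb{Z}$, with $(X[k])^i=X^{i+k}$ (including $X[0]=X$). For $Z\in\mathbf{C}_{[0,n]}(\mathrm{proj}\,A)$, $F(Z)\in\mathbf{C}_n(\mathrm{proj}\,A)$ is the hard truncation $Z^1\to\cdots\to Z^n$. For $Z\in\mathbf{C}_{n+1}(\mathrm{proj}\,A)$, $G(Z)\in\mathbf{C}_n(\mathrm{proj}\,A)$ is the hard truncation $Z^1\to\cdots\to Z^n$. Let $X$ be an indecomposable complex in $\mathbf{C}_n(\mathrm{proj}\,A)$. A left enlargement of $X$ is an indecomposable complex $Z\in\mathbf{C}_{[0,n]}(\mathrm{proj}\,A)$ with $Z^0\ne0$ such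 that $X$ is a direct summand of $F(Z)$ in $\mathbf{C}_n(\mathrm{proj}\,A)$. A right enlargement of $X$ is an indecomposable complex $Z\in\mathbf{C}_{n+1}(\mathrm{proj}\,A)$ with $Z^{n+1}\ne0$ such that $X$ is a direct summand of $G(Z)$ in $\mathbf{C}_n(\mathrm{proj}\,A)$. *)

theory Defs
  imports "HOL-Algebra.Module" "HOL-Algebra.Ideal"
begin

section \<open>Modules over a noncommutative ring\<close>

text \<open>
  The locale \<^locale>\<open>module\<close> of HOL-Algebra asks for a commutative ring of scalars, so left modules
  over an arbitrary ring are introduced here, on the same record type \<^typ>\<open>('a, 'm) module\<close>.
  As usual for that type, the multiplicative fields of the record of a module are irrelevant.
\<close>

locale left_module = A?: ring A + M?: abelian_group M
  for A (structure) and M :: "('a, 'm) module" (structure) +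
  assumes smult_closed [simp, intro]:
      "\<lbrakk>a \<in> carrier A; x \<in> carrier M\<rbrakk> \<Longrightarrow> a \<odot>\<^bsub>M\<^esub> x \<in> carrier M"
    and smult_l_distr:
      "\<lbrakk>a \<in> carrier A; b \<in> carrier A; x \<in> carrier M\<rbrakk> \<Longrightarrow>
        (a \<oplus>\<^bsub>A\<^esub> b) \<odot>\<^bsub>M\<^esub> x = a \<odot>\<^bsub>M\<^esub> x \<oplus>\<^bsub>M\<^esub> b \<odot>\<^bsub>M\<^esub> x"
    and smult_r_distr:
      "\<lbrakk>a \<in> carrier A; x \<in> carrier M; y \<in> carrier M\<rbrakk> \<Longrightarrow>
        a \<odot>\<^bsub>M\<^esub> (x \<oplus>\<^bsub>M\<^esub> y) = a \<odot>\<^bsub>M\<^esub> x \<oplus>\<^bsub>M\<^esub> a \<odot>\<^bsub>M\<^esub> y"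
    and smult_assoc:
      "\<lbrakk>a \<in> carrier A; b \<in> carrier A; x \<in> carrier M\<rbrakk> \<Longrightarrow>
        (a \<otimes>\<^bsub>A\<^esub> b) \<odot>\<^bsub>M\<^esub> x = a \<odot>\<^bsub>M\<^esub> (b \<odot>\<^bsub>M\<^esub> x)"
    and smult_one [simp]: "x \<in> carrier M \<Longrightarrow> \<one>\<^bsub>A\<^esub> \<odot>\<^bsub>M\<^esub> x = x"

definition zero_module :: "('a, 'm) module \<Rightarrow> bool" where
  "zero_module M \<longleftrightarrow> carrier M = {\<zero>\<^bsub>M\<^esub>}"

definition module_hom ::
    "('a, 'e) ring_scheme \<Rightarrow> ('a, 'm) module \<Rightarrow> ('a, 'p) module \<Rightarrow> ('m \<Rightarrow> 'p) set" where
  "module_hom A M N = {f \<in> carrier M \<rightarrow> carrier N.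
     (\<forall>x\<in>carrier M. \<forall>y\<in>carrier M. f (x \<oplus>\<^bsub>M\<^esub> y) = f x \<oplus>\<^bsub>N\<^esub> f y) \<and>
     (\<forall>a\<in>carrier A. \<forall>x\<in>carrier M. f (a \<odot>\<^bsub>M\<^esub> x) = a \<odot>\<^bsub>N\<^esub> f x)}"

definition finitely_generated ::
    "('a, 'e) ring_scheme \<Rightarrow> ('a, 'm) module \<Rightarrow> bool" where
  "finitely_generated A M \<longleftrightarrow>
     (\<exists>S. finite S \<and> S \<subseteq> carrier M \<and> (\<forall>N. submodule N A M \<and> S \<subseteq> N \<longrightarrow> N = carrier M))"

text \<open>
  The lifting property of a projective module. HOL cannot quantify over all carrier types, so the
  lifting problems \<open>L \<rightarrow> N \<leftarrow> P\<close> range over \<open>L\<close> carried by the type \<^typ>\<open>nat \<Rightarrow> 'a\<close>, which has room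
  for every free module \<open>A\<^sup>k\<close>, and over \<open>N\<close> carried by the type of \<open>P\<close>. For finitely generated \<open>P\<close>
  (the only case used) nothing is lost: lifting the identity of \<open>P\<close> along a surjection
  \<open>A\<^sup>k \<rightarrow> P\<close> makes \<open>P\<close> a direct summand of \<open>A\<^sup>k\<close>, whence the lifting property for modules
  over all types.
\<close>

definition projective_module :: "('a, 'e) ring_scheme \<Rightarrow> ('a, 'm) module \<Rightarrow> bool" where
  "projective_module A P \<longleftrightarrow> left_module A P \<and>
     (\<forall>(L :: ('a, nat \<Rightarrow> 'a) module) (N :: ('a, 'm) module) g f.
        left_module A L \<and> left_module A N \<and>
        g \<in> module_hom A L N \<and> g ` carrier L = carrier N \<and> f \<in> module_hom A P N \<longrightarrow>
        (\<exists>h\<in>module_hom A P L. \<forall>x\<in>carrier P. g (h x) = f x))"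

definition proj :: "('a, 'e) ring_scheme \<Rightarrow> ('a, 'm) module set" where
  "proj A = {P. left_module A P \<and> finitely_generated A P \<and> projective_module A P}"

definition module_sum ::
    "('a, 'm) module \<Rightarrow> ('a, 'p) module \<Rightarrow> ('a, 'm \<times> 'p) module" where
  "module_sum M N =
     \<lparr>carrier = carrier M \<times> carrier N,
      mult = undefined,
      one = undefined,
      zero = (\<zero>\<^bsub>M\<^esub>, \<zero>\<^bsub>N\<^esub>),
      add = (\<lambda>(x, y) (x', y'). (x \<oplus>\<^bsub>M\<^esub> x', y \<oplus>\<^bsub>N\<^esub> y')),
      smult = (\<lambda>a (x, y). (a \<odot>\<^bsub>M\<^esub> x, a \<odot>\<^bsub>N\<^esub> y))\<rparr>"


section \<open>Artin algebras\<close>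

locale artinian_cring = cring R for R (structure) +
  assumes ideal_dcc:
    "\<lbrakk>\<And>k :: nat. ideal (I k) R; \<And>k. I (Suc k) \<subseteq> I k\<rbrakk> \<Longrightarrow> \<exists>k. \<forall>l\<ge>k. I l = I k"

text \<open>
  The two associativity laws say that \<open>R\<close> acts through the centre of \<open>A\<close>; compare the locale
  \<^locale>\<open>algebra\<close>, which requires \<open>A\<close> to be commutative.
\<close>

locale artin_algebra = R?: artinian_cring R + module R A + A?: ring A
  for R (structure) and A :: "('r, 'a) module" (structure) +
  assumes smult_mult_left:
      "\<lbrakk>r \<in> carrier R; x \<in> carrier A; y \<in> carrier A\<rbrakk> \<Longrightarrow>
        (r \<odot>\<^bsub>A\<^esub> x) \<otimes>\<^bsub>A\<^esub> y = r \<odot>\<^bsub>A\<^esub> (x \<otimes>\<^bsub>A\<^esub> y)"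
    and smult_mult_right:
      "\<lbrakk>r \<in> carrier R; x \<in> carrier A; y \<in> carrier A\<rbrakk> \<Longrightarrow>
        x \<otimes>\<^bsub>A\<^esub> (r \<odot>\<^bsub>A\<^esub> y) = r \<odot>\<^bsub>A\<^esub> (x \<otimes>\<^bsub>A\<^esub> y)"
    and finitely_generated: "finitely_generated R A"


section \<open>Complexes\<close>

record ('a, 'm) cochain =
  obj :: "int \<Rightarrow> ('a, 'm) module"
  diff :: "int \<Rightarrow> 'm \<Rightarrow> 'm"

text \<open>
  Differentials are extensional, so that two complexes with the same modules are equal as soon as
  their differentials agree on the carriers.
\<close>

definition cochain_complex :: "('a, 'e) ring_scheme \<Rightarrow> ('a, 'm) cochain \<Rightarrow> bool" where
  "cochain_complex A X \<longleftrightarrow>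
     (\<forall>i. left_module A (obj X i) \<and>
          diff X i \<in> module_hom A (obj X i) (obj X (i + 1)) \<inter> extensional (carrier (obj X i)) \<and>
          (\<forall>x\<in>carrier (obj X i). diff X (i + 1) (diff X i x) = \<zero>\<^bsub>obj X (i + 2)\<^esub>))"

definition zero_complex :: "('a, 'm) cochain \<Rightarrow> bool" where
  "zero_complex X \<longleftrightarrow> (\<forall>i. zero_module (obj X i))"

definition C_proj ::
    "('a, 'e) ring_scheme \<Rightarrow> int \<Rightarrow> int \<Rightarrow> ('a, 'm) cochain set" where
  "C_proj A m n = {X. cochain_complex A X \<and> (\<forall>i. obj X i \<in> proj A) \<and>
                      (\<forall>i. i \<notin> {m..n} \<longrightarrow> zero_module (obj X i))}"

definition chain_map ::
    "('a, 'e) ring_scheme \<Rightarrow> ('a, 'm) cochain \<Rightarrow> ('a, 'p) cochain \<Rightarrow> (int \<Rightarrow> 'm \<Rightarrow> 'p) set" where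
  "chain_map A X Y = {f. \<forall>i. f i \<in> module_hom A (obj X i) (obj Y i) \<and>
     (\<forall>x\<in>carrier (obj X i). f (i + 1) (diff X i x) = diff Y i (f i x))}"

definition complex_iso ::
    "('a, 'e) ring_scheme \<Rightarrow> ('a, 'm) cochain \<Rightarrow> ('a, 'p) cochain \<Rightarrow> bool" where
  "complex_iso A X Y \<longleftrightarrow> (\<exists>f\<in>chain_map A X Y. \<exists>g\<in>chain_map A Y X. \<forall>i.
     (\<forall>x\<in>carrier (obj X i). g i (f i x) = x) \<and> (\<forall>y\<in>carrier (obj Y i). f i (g i y) = y))"

definition complex_sum ::
    "('a, 'm) cochain \<Rightarrow> ('a, 'p) cochain \<Rightarrow> ('a, 'm \<times> 'p) cochain" where
  "complex_sum X Y =
     \<lparr>obj = (\<lambda>i. module_sum (obj X i) (obj Y i)),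
      diff = (\<lambda>i. restrict (map_prod (diff X i) (diff Y i))
                            (carrier (module_sum (obj X i) (obj Y i))))\<rparr>"

text \<open>
  In the following two definitions \<open>\<C>\<close> is a full subcategory of complexes. Letting the complementary
  summands range over complexes on the same carrier type as the complex being decomposed is no
  restriction: every summand of \<open>X\<close> is isomorphic to a subcomplex of \<open>X\<close>.
\<close>

definition indecomposable_in ::
    "('a, 'e) ring_scheme \<Rightarrow> ('a, 'm) cochain set \<Rightarrow> ('a, 'm) cochain \<Rightarrow> bool" where
  "indecomposable_in A \<C> X \<longleftrightarrow> X \<in> \<C> \<and> \<not> zero_complex X \<and>
     (\<forall>Y\<in>\<C>. \<forall>W\<in>\<C>. complex_iso A X (complex_sum Y W) \<longrightarrow> zero_complex Y \<or> zero_complex W)"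

definition direct_summand_in ::
    "('a, 'e) ring_scheme \<Rightarrow> ('a, 'm) cochain set \<Rightarrow> ('a, 'm) cochain \<Rightarrow> ('a, 'm) cochain \<Rightarrow> bool" where
  "direct_summand_in A \<C> X Y \<longleftrightarrow> X \<in> \<C> \<and> Y \<in> \<C> \<and> (\<exists>W\<in>\<C>. complex_iso A Y (complex_sum X W))"

text \<open>
  The shift \<open>X[k]\<close>, with the usual sign \<open>(-1)\<^sup>k\<close> on the differential.
\<close>

definition shift :: "('a, 'm) cochain \<Rightarrow> int \<Rightarrow> ('a, 'm) cochain" where
  "shift X k =
     \<lparr>obj = (\<lambda>i. obj X (i + k)),
      diff = (\<lambda>i. if even k then diff X (i + k)
                  else (\<lambda>x\<in>carrier (obj X (i + k)). \<ominus>\<^bsub>obj X (i + k + 1)\<^esub> diff X (i + k) x))\<rparr>"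

definition hard_trunc :: "int \<Rightarrow> int \<Rightarrow> ('a, 'm) cochain \<Rightarrow> ('a, 'm) cochain" where
  "hard_trunc m n Z =
     \<lparr>obj = (\<lambda>i. if i \<in> {m..n} then obj Z i else (obj Z i)\<lparr>carrier := {\<zero>\<^bsub>obj Z i\<^esub>}\<rparr>),
      diff = (\<lambda>i. if m \<le> i \<and> i < n then diff Z i
                  else (\<lambda>x\<in>(if i \<in> {m..n} then carrier (obj Z i) else {\<zero>\<^bsub>obj Z i\<^esub>}).
                          \<zero>\<^bsub>obj Z (i + 1)\<^esub>))\<rparr>"

text \<open>
  The functors \<open>F\<close> and \<open>G\<close> are both given by \<^term>\<open>hard_trunc 1 n\<close>, on different categories.
\<close>

definition left_enlargement ::
    "('a, 'e) ring_scheme \<Rightarrow> int \<Rightarrow> ('a, 'm) cochain \<Rightarrow> ('a, 'm) cochain \<Rightarrow> bool" where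
  "left_enlargement A n X Z \<longleftrightarrow>
     indecomposable_in A (C_proj A 0 n) Z \<and> \<not> zero_module (obj Z 0) \<and>
     direct_summand_in A (C_proj A 1 n) X (hard_trunc 1 n Z)"

definition right_enlargement ::
    "('a, 'e) ring_scheme \<Rightarrow> int \<Rightarrow> ('a, 'm) cochain \<Rightarrow> ('a, 'm) cochain \<Rightarrow> bool" where
  "right_enlargement A n X Z \<longleftrightarrow>
     indecomposable_in A (C_proj A 1 (n + 1)) Z \<and> \<not> zero_module (obj Z (n + 1)) \<and>
     direct_summand_in A (C_proj A 1 n) X (hard_trunc 1 n Z)"

end

theory Submission
  imports Defs
begin

text \<open>
  If \<open>Z\<close> vanishes in the extra degree, it already lies in the smaller category, and if its
  truncation is zero, it is concentrated in the extra degree and shifting by one moves it into the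
  smaller category. Otherwise any indecomposable direct summand of the truncation will do.
  Such a summand exists because finitely generated modules over an artin algebra satisfy the
  descending chain condition: among the nonzero idempotent chain endomorphisms choose one with
  minimal image.
\<close>

section \<open>Descending chains of submodules\<close>

text \<open>Indecomposability is tested against complements on the carrier type \<open>'m\<close> of
  the complex itself, whereas \<open>complex_sum\<close> lives on \<open>'m \<times> 'm\<close>.
  Descending through abstract summands would give complexes that are related only by isomorphisms.
  Idempotents of one fixed complex avoid this: the image of \<open>e\<close> is a subcomplex on the
  same type, the image of \<open>1 - e\<close> is its complement, and a decomposition of the image
  is converted back into an idempotent of the original complex, so all stages are comparable by
  inclusion. Images stay projective because they are retracts. The chain condition originates in the
  commutative base ring: \<open>A\<close> is finitely generated over the artinian ring
  \<open>R\<close> and its left ideals are \<open>R\<close>-submodules, so \<open>A\<close> is left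
  artinian, and the property then spreads to finitely generated \<open>A\<close>-modules. It acts on
  one degree at a time; boundedness of the complex is what makes the stationary index uniform. The
  left and right statements differ only in the extra degree \<open>j\<close> and in the shift
  \<open>k\<close> that moves it into range, so both are instances of a single lemma.\<close>

context left_module
begin

lemma smult_l_null [simp]:
  assumes "x \<in> carrier M"
  shows "\<zero>\<^bsub>A\<^esub> \<odot>\<^bsub>M\<^esub> x = \<zero>\<^bsub>M\<^esub>"
proof -
  have "\<zero>\<^bsub>A\<^esub> \<odot>\<^bsub>M\<^esub> x \<oplus>\<^bsub>M\<^esub> \<zero>\<^bsub>A\<^esub> \<odot>\<^bsub>M\<^esub> x = \<zero>\<^bsub>A\<^esub> \<odot>\<^bsub>M\<^esub> x"
    using assms smult_l_distr[of "\<zero>\<^bsub>A\<^esub>" "\<zero>\<^bsub>A\<^esub>" x] by simp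
  then show ?thesis
    using assms by (metis A.zero_closed M.add.l_cancel_one smult_closed)
qed

lemma smult_r_null [simp]:
  assumes "a \<in> carrier A"
  shows "a \<odot>\<^bsub>M\<^esub> \<zero>\<^bsub>M\<^esub> = \<zero>\<^bsub>M\<^esub>"
proof -
  have "a \<odot>\<^bsub>M\<^esub> \<zero>\<^bsub>M\<^esub> \<oplus>\<^bsub>M\<^esub> a \<odot>\<^bsub>M\<^esub> \<zero>\<^bsub>M\<^esub> = a \<odot>\<^bsub>M\<^esub> \<zero>\<^bsub>M\<^esub>"
    using assms smult_r_distr[of a "\<zero>\<^bsub>M\<^esub>" "\<zero>\<^bsub>M\<^esub>"] by simp
  then show ?thesis
    using assms by (metis M.zero_closed M.add.l_cancel_one smult_closed)
qed

text \<open>Turning negation into a scalar action lets closure of submodules under negatives,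
  compatibility of homomorphisms with negatives, and the sign in \<open>shift\<close> all follow
  from linearity.\<close>

lemma smult_minus_one:
  assumes "x \<in> carrier M"
  shows "(\<ominus>\<^bsub>A\<^esub> \<one>\<^bsub>A\<^esub>) \<odot>\<^bsub>M\<^esub> x = \<ominus>\<^bsub>M\<^esub> x"
proof -
  have "(\<ominus>\<^bsub>A\<^esub> \<one>\<^bsub>A\<^esub>) \<odot>\<^bsub>M\<^esub> x \<oplus>\<^bsub>M\<^esub> x = (\<ominus>\<^bsub>A\<^esub> \<one>\<^bsub>A\<^esub> \<oplus>\<^bsub>A\<^esub> \<one>\<^bsub>A\<^esub>) \<odot>\<^bsub>M\<^esub> x"
    using assms by (subst smult_l_distr) auto
  also have "\<dots> = \<zero>\<^bsub>M\<^esub>"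
    using assms by (simp add: A.l_neg)
  finally show ?thesis
    using assms by (metis A.a_inv_closed A.one_closed M.minus_equality smult_closed)
qed

lemma smult_r_minus:
  assumes "a \<in> carrier A" "x \<in> carrier M"
  shows "a \<odot>\<^bsub>M\<^esub> (\<ominus>\<^bsub>M\<^esub> x) = \<ominus>\<^bsub>M\<^esub> (a \<odot>\<^bsub>M\<^esub> x)"
proof -
  have "a \<odot>\<^bsub>M\<^esub> (\<ominus>\<^bsub>M\<^esub> x) \<oplus>\<^bsub>M\<^esub> a \<odot>\<^bsub>M\<^esub> x = \<zero>\<^bsub>M\<^esub>"
    using assms by (simp add: smult_r_distr[symmetric] M.l_neg)
  then show ?thesis
    using assms by (metis M.a_inv_closed M.minus_equality smult_closed)
qed

text \<open>Closure under negatives is not a premise because it is multiplication by the scalar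
  -1.\<close>

lemma submoduleI:
  assumes "H \<subseteq> carrier M" "\<zero>\<^bsub>M\<^esub> \<in> H"
    and "\<And>x y. \<lbrakk>x \<in> H; y \<in> H\<rbrakk> \<Longrightarrow> x \<oplus>\<^bsub>M\<^esub> y \<in> H"
    and "\<And>a x. \<lbrakk>a \<in> carrier A; x \<in> H\<rbrakk> \<Longrightarrow> a \<odot>\<^bsub>M\<^esub> x \<in> H"
  shows "submodule H A M"
proof -
  have "\<ominus>\<^bsub>M\<^esub> x \<in> H" if "x \<in> H" for x
    using assms(1) assms(4)[of "\<ominus>\<^bsub>A\<^esub> \<one>\<^bsub>A\<^esub>" x] smult_minus_one[of x] that by auto
  then show ?thesis
    using assms by (intro submodule.intro subgroup.intro submodule_axioms.intro) (auto simp: a_inv_def)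
qed

lemma submoduleD:
  assumes "submodule H A M"
  shows "H \<subseteq> carrier M" "\<zero>\<^bsub>M\<^esub> \<in> H"
    and "\<And>x y. \<lbrakk>x \<in> H; y \<in> H\<rbrakk> \<Longrightarrow> x \<oplus>\<^bsub>M\<^esub> y \<in> H"
    and "\<And>x. x \<in> H \<Longrightarrow> \<ominus>\<^bsub>M\<^esub> x \<in> H"
    and "\<And>a x. \<lbrakk>a \<in> carrier A; x \<in> H\<rbrakk> \<Longrightarrow> a \<odot>\<^bsub>M\<^esub> x \<in> H"
proof -
  interpret submodule H A M by fact
  show "H \<subseteq> carrier M" "\<zero>\<^bsub>M\<^esub> \<in> H"
    "\<And>x y. \<lbrakk>x \<in> H; y \<in> H\<rbrakk> \<Longrightarrow> x \<oplus>\<^bsub>M\<^esub> y \<in> H"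
    "\<And>x. x \<in> H \<Longrightarrow> \<ominus>\<^bsub>M\<^esub> x \<in> H"
    "\<And>a x. \<lbrakk>a \<in> carrier A; x \<in> H\<rbrakk> \<Longrightarrow> a \<odot>\<^bsub>M\<^esub> x \<in> H"
    using subset one_closed m_closed m_inv_closed smult_closed by (auto simp: a_inv_def)
qed

lemma left_module_submodule:
  assumes "submodule H A M"
  shows "left_module A (M\<lparr>carrier := H\<rparr>)"
proof -
  note H = submoduleD[OF assms]
  have "abelian_group (M\<lparr>carrier := H\<rparr>)"
  proof (rule abelian_groupI, simp_all add: H)
    show "\<exists>y\<in>H. y \<oplus>\<^bsub>M\<^esub> x = \<zero>\<^bsub>M\<^esub>" if "x \<in> H" for x
      using that H by (intro bexI[of _ "\<ominus>\<^bsub>M\<^esub> x"]) (auto intro: M.l_neg)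
  qed (use H(1) in \<open>auto simp: subset_iff M.a_ac\<close>)
  then show ?thesis
    using H by (intro left_module.intro left_module_axioms.intro A.ring_axioms)
      (auto simp: subset_iff smult_l_distr smult_r_distr smult_assoc)
qed

end

section \<open>The chain condition, from the ring to finitely generated modules\<close>

text \<open>Its submodules are the left ideals of \<open>K\<close>, so
  \<open>submodule_dcc K (regular_module K)\<close> expresses that \<open>K\<close> is left
  artinian.\<close>

definition regular_module :: "('a, 'e) ring_scheme \<Rightarrow> ('a, 'a) module" where
  "regular_module K =
     \<lparr>carrier = carrier K, mult = mult K, one = one K, zero = zero K, add = add K, smult = mult K\<rparr>"

lemma regular_module_simps [simp]:
  "carrier (regular_module K) = carrier K"
  "zero (regular_module K) = zero K"
  "add (regular_module K) = add K"
  "smult (regular_module K) = mult K"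
  by (simp_all add: regular_module_def)

lemma left_module_regular: "ring K \<Longrightarrow> left_module K (regular_module K)"
proof -
  assume "ring K"
  then interpret ring K .
  have "abelian_group (regular_module K)"
    by (rule abelian_groupI) (auto simp: a_ac intro: exI[of _ "\<ominus>\<^bsub>K\<^esub> _"] l_neg)
  then show ?thesis
    by (intro left_module.intro left_module_axioms.intro ring_axioms)
      (auto simp: l_distr r_distr m_assoc)
qed

definition submodule_dcc :: "('a, 'e) ring_scheme \<Rightarrow> ('a, 'm) module \<Rightarrow> bool" where
  "submodule_dcc K M \<longleftrightarrow>
     (\<forall>N :: nat \<Rightarrow> 'm set. (\<forall>k. submodule (N k) K M \<and> N (Suc k) \<subseteq> N k) \<longrightarrow> (\<exists>k. \<forall>l\<ge>k. N l = N k))"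

text \<open>Induction on the generators. Adding a generator \<open>s\<close> to a submodule
  \<open>T\<close> extends \<open>T\<close> by a cyclic module, and extensions preserve the chain
  condition. The quotient of \<open>As + T\<close> by \<open>T\<close> is never formed: the left
  ideals of coefficients at \<open>s\<close> replace it.\<close>

lemma (in left_module) submodule_dcc_finitely_generated:
  assumes dcc: "submodule_dcc A (regular_module A)" and fg: "finitely_generated A M"
  shows "submodule_dcc A M"
proof -
  \<comment> \<open>The invariant concerns chains of submodules of the whole \<open>M\<close>, cut
    down to \<open>T\<close>, so the ambient module stays fixed throughout the induction. Once
    \<open>T\<close> contains generators of \<open>M\<close>, the intersections are the chain
    itself.\<close>
  have *: "\<exists>T. S \<subseteq> T \<and> submodule T A M \<and>
      (\<forall>N :: nat \<Rightarrow> 'm set. (\<forall>k. submodule (N k) A M \<and> N (Suc k) \<subseteq> N k) \<longrightarrow> (\<exists>k. \<forall>l\<ge>k. N l \<inter> T = N k \<inter> T))"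
    if "finite S" "S \<subseteq> carrier M" for S
    using that
  proof (induction S rule: finite_induct)
    case empty
    have "submodule {\<zero>\<^bsub>M\<^esub>} A M"
      by (rule submoduleI) auto
    moreover have "N l \<inter> {\<zero>\<^bsub>M\<^esub>} = N 0 \<inter> {\<zero>\<^bsub>M\<^esub>}" if "\<forall>k. submodule (N k) A M" for N :: "nat \<Rightarrow> _" and l
      using submoduleD(2) that by blast
    ultimately show ?case
      by (intro exI[of _ "{\<zero>\<^bsub>M\<^esub>}"]) blast
  next
    case (insert s S)
    then obtain T where T: "S \<subseteq> T" "submodule T A M"
      and stat: "\<And>N :: nat \<Rightarrow> 'm set. (\<forall>k. submodule (N k) A M \<and> N (Suc k) \<subseteq> N k) \<Longrightarrow>
        (\<exists>k. \<forall>l\<ge>k. N l \<inter> T = N k \<inter> T)"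
      by auto
    note Tm = submoduleD[OF T(2)]
    have s: "s \<in> carrier M" using insert by auto
    define T' where "T' = {r \<odot>\<^bsub>M\<^esub> s \<oplus>\<^bsub>M\<^esub> y |r y. r \<in> carrier A \<and> y \<in> T}"
    have T'I: "r \<odot>\<^bsub>M\<^esub> s \<oplus>\<^bsub>M\<^esub> y \<in> T'" if "r \<in> carrier A" "y \<in> T" for r y
      using that by (auto simp: T'_def)
    have "submodule T' A M"
    proof (rule submoduleI)
      show "T' \<subseteq> carrier M"
        using Tm(1) s by (auto simp: T'_def)
      show "\<zero>\<^bsub>M\<^esub> \<in> T'"
        using T'I[of "\<zero>\<^bsub>A\<^esub>" "\<zero>\<^bsub>M\<^esub>"] Tm s by simp
    next
      fix x y assume "x \<in> T'" "y \<in> T'"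
      then obtain r u q v where x: "x = r \<odot>\<^bsub>M\<^esub> s \<oplus>\<^bsub>M\<^esub> u" "y = q \<odot>\<^bsub>M\<^esub> s \<oplus>\<^bsub>M\<^esub> v"
        and m: "r \<in> carrier A" "q \<in> carrier A" "u \<in> T" "v \<in> T"
        by (auto simp: T'_def)
      have mc: "u \<in> carrier M" "v \<in> carrier M" using m Tm by auto
      have "x \<oplus>\<^bsub>M\<^esub> y = (r \<oplus>\<^bsub>A\<^esub> q) \<odot>\<^bsub>M\<^esub> s \<oplus>\<^bsub>M\<^esub> (u \<oplus>\<^bsub>M\<^esub> v)"
        using m mc s by (simp add: x smult_l_distr M.a_ac)
      then show "x \<oplus>\<^bsub>M\<^esub> y \<in> T'"
        using T'I m Tm by simp
    next
      fix a x assume a: "a \<in> carrier A" "x \<in> T'"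
      then obtain r u where x: "x = r \<odot>\<^bsub>M\<^esub> s \<oplus>\<^bsub>M\<^esub> u" and m: "r \<in> carrier A" "u \<in> T"
        by (auto simp: T'_def)
      have mc: "u \<in> carrier M" using m Tm by auto
      have "a \<odot>\<^bsub>M\<^esub> x = (a \<otimes>\<^bsub>A\<^esub> r) \<odot>\<^bsub>M\<^esub> s \<oplus>\<^bsub>M\<^esub> a \<odot>\<^bsub>M\<^esub> u"
        using a m mc s by (simp add: x smult_r_distr smult_assoc)
      then show "a \<odot>\<^bsub>M\<^esub> x \<in> T'"
        using T'I m Tm a by simp
    qed
    moreover have "insert s S \<subseteq> T'"
    proof -
      have "s \<in> T'"
        using T'I[of "\<one>\<^bsub>A\<^esub>" "\<zero>\<^bsub>M\<^esub>"] Tm s by simp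
      moreover have "y \<in> T'" if "y \<in> T" for y
        using T'I[of "\<zero>\<^bsub>A\<^esub>" y] that Tm s by auto
      ultimately show ?thesis
        using T(1) by auto
    qed
    moreover have "\<exists>k. \<forall>l\<ge>k. N l \<inter> T' = N k \<inter> T'"
      if N: "\<forall>k. submodule (N k) A M \<and> N (Suc k) \<subseteq> N k" for N :: "nat \<Rightarrow> 'm set"
    proof -
      have Nm: "submodule (N k) A M" for k using N by auto
      have anti: "N l \<subseteq> N k" if "k \<le> l" for k l
        using lift_Suc_antimono_le[of N k l] N that by auto
      \<comment> \<open>A chain in \<open>A s + T\<close> is determined by its coefficients at \<open>s\<close> and its intersections with \<open>T\<close>.\<close>
      define I where "I k = {r \<in> carrier A. \<exists>y\<in>T. r \<odot>\<^bsub>M\<^esub> s \<oplus>\<^bsub>M\<^esub> y \<in> N k}" for k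
      interpret reg: left_module A "regular_module A"
        by (rule left_module_regular) (rule A.ring_axioms)
      have "submodule (I k) A (regular_module A)" for k
      proof (rule reg.submoduleI)
        show "I k \<subseteq> carrier (regular_module A)"
          by (auto simp: I_def)
        show "\<zero>\<^bsub>regular_module A\<^esub> \<in> I k"
          using Tm submoduleD(2)[OF Nm] s by (auto simp: I_def intro!: bexI[of _ "\<zero>\<^bsub>M\<^esub>"])
      next
        fix x y assume "x \<in> I k" "y \<in> I k"
        then obtain u v where m: "x \<in> carrier A" "y \<in> carrier A" "u \<in> T" "v \<in> T"
            "x \<odot>\<^bsub>M\<^esub> s \<oplus>\<^bsub>M\<^esub> u \<in> N k" "y \<odot>\<^bsub>M\<^esub> s \<oplus>\<^bsub>M\<^esub> v \<in> N k"
          by (auto simp: I_def)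
        have mc: "u \<in> carrier M" "v \<in> carrier M" using m Tm by auto
        have "(x \<odot>\<^bsub>M\<^esub> s \<oplus>\<^bsub>M\<^esub> u) \<oplus>\<^bsub>M\<^esub> (y \<odot>\<^bsub>M\<^esub> s \<oplus>\<^bsub>M\<^esub> v) = (x \<oplus>\<^bsub>A\<^esub> y) \<odot>\<^bsub>M\<^esub> s \<oplus>\<^bsub>M\<^esub> (u \<oplus>\<^bsub>M\<^esub> v)"
          using m mc s by (simp add: smult_l_distr M.a_ac)
        then have "(x \<oplus>\<^bsub>A\<^esub> y) \<odot>\<^bsub>M\<^esub> s \<oplus>\<^bsub>M\<^esub> (u \<oplus>\<^bsub>M\<^esub> v) \<in> N k"
          using submoduleD(3)[OF Nm m(5,6)] by simp
        then show "x \<oplus>\<^bsub>regular_module A\<^esub> y \<in> I k"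
          using m Tm by (auto simp: I_def)
      next
        fix a x assume a: "a \<in> carrier A" "x \<in> I k"
        then obtain u where m: "x \<in> carrier A" "u \<in> T" "x \<odot>\<^bsub>M\<^esub> s \<oplus>\<^bsub>M\<^esub> u \<in> N k"
          by (auto simp: I_def)
        have mc: "u \<in> carrier M" using m Tm by auto
        have "a \<odot>\<^bsub>M\<^esub> (x \<odot>\<^bsub>M\<^esub> s \<oplus>\<^bsub>M\<^esub> u) = (a \<otimes>\<^bsub>A\<^esub> x) \<odot>\<^bsub>M\<^esub> s \<oplus>\<^bsub>M\<^esub> a \<odot>\<^bsub>M\<^esub> u"
          using a m mc s by (simp add: smult_r_distr smult_assoc)
        then have "(a \<otimes>\<^bsub>A\<^esub> x) \<odot>\<^bsub>M\<^esub> s \<oplus>\<^bsub>M\<^esub> a \<odot>\<^bsub>M\<^esub> u \<in> N k"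
          using submoduleD(5)[OF Nm a(1) m(3)] by simp
        then show "a \<odot>\<^bsub>regular_module A\<^esub> x \<in> I k"
          using m Tm a by (auto simp: I_def)
      qed
      moreover have "I (Suc k) \<subseteq> I k" for k
        using N by (auto simp: I_def)
      ultimately obtain k1 where k1: "\<And>l. l \<ge> k1 \<Longrightarrow> I l = I k1"
        using dcc unfolding submodule_dcc_def by meson
      obtain k2 where k2: "\<And>l. l \<ge> k2 \<Longrightarrow> N l \<inter> T = N k2 \<inter> T"
        using stat[OF N] by auto
      define K where "K = max k1 k2"
      have "N l \<inter> T' = N K \<inter> T'" if l: "l \<ge> K" for l
      proof
        show "N l \<inter> T' \<subseteq> N K \<inter> T'"
          using anti l by auto
        show "N K \<inter> T' \<subseteq> N l \<inter> T'"
        proof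
          fix z assume z: "z \<in> N K \<inter> T'"
          then obtain r y where ry: "r \<in> carrier A" "y \<in> T" "z = r \<odot>\<^bsub>M\<^esub> s \<oplus>\<^bsub>M\<^esub> y"
            by (auto simp: T'_def)
          \<comment> \<open>The coefficient \<open>r\<close> also occurs in \<open>N l\<close>, with
            some other remainder \<open>y'\<close>. The difference \<open>y - y'\<close> lies in
            \<open>N K\<close> and in \<open>T\<close>, hence in \<open>N l\<close>; adding it to
            \<open>r s + y'\<close> recovers \<open>z\<close>.\<close>
          have "r \<in> I K"
            using z ry by (auto simp: I_def)
          also have "I K = I l"
            using k1[of K] k1[of l] l by (simp add: K_def)
          finally obtain y' where y': "y' \<in> T" "r \<odot>\<^bsub>M\<^esub> s \<oplus>\<^bsub>M\<^esub> y' \<in> N l"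
            by (auto simp: I_def)
          have yc: "y \<in> carrier M" "y' \<in> carrier M"
            using ry y' Tm by auto
          have rs: "r \<odot>\<^bsub>M\<^esub> s \<in> carrier M"
            using ry s by simp
          have eq: "z \<oplus>\<^bsub>M\<^esub> \<ominus>\<^bsub>M\<^esub> (r \<odot>\<^bsub>M\<^esub> s \<oplus>\<^bsub>M\<^esub> y') = y \<oplus>\<^bsub>M\<^esub> \<ominus>\<^bsub>M\<^esub> y'"
          proof -
            have "z \<oplus>\<^bsub>M\<^esub> \<ominus>\<^bsub>M\<^esub> (r \<odot>\<^bsub>M\<^esub> s \<oplus>\<^bsub>M\<^esub> y') = (y \<oplus>\<^bsub>M\<^esub> \<ominus>\<^bsub>M\<^esub> y') \<oplus>\<^bsub>M\<^esub> (r \<odot>\<^bsub>M\<^esub> s \<oplus>\<^bsub>M\<^esub> \<ominus>\<^bsub>M\<^esub> (r \<odot>\<^bsub>M\<^esub> s))"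
              using yc rs by (simp add: ry(3) M.minus_add M.a_ac del: M.r_neg1 M.r_neg2 M.r_neg)
            then show ?thesis
              using yc rs by (simp add: M.r_neg)
          qed
          have "z \<oplus>\<^bsub>M\<^esub> \<ominus>\<^bsub>M\<^esub> (r \<odot>\<^bsub>M\<^esub> s \<oplus>\<^bsub>M\<^esub> y') \<in> N K"
            using z y' anti[OF l] submoduleD(3,4)[OF Nm[of K]] by auto
          then have "y \<oplus>\<^bsub>M\<^esub> \<ominus>\<^bsub>M\<^esub> y' \<in> N K \<inter> T"
            using eq ry y' Tm by auto
          also have "N K \<inter> T = N l \<inter> T"
            using k2[of K] k2[of l] l by (simp add: K_def)
          finally have "(y \<oplus>\<^bsub>M\<^esub> \<ominus>\<^bsub>M\<^esub> y') \<oplus>\<^bsub>M\<^esub> (r \<odot>\<^bsub>M\<^esub> s \<oplus>\<^bsub>M\<^esub> y') \<in> N l"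
            using y' submoduleD(3)[OF Nm[of l]] by blast
          moreover have "(y \<oplus>\<^bsub>M\<^esub> \<ominus>\<^bsub>M\<^esub> y') \<oplus>\<^bsub>M\<^esub> (r \<odot>\<^bsub>M\<^esub> s \<oplus>\<^bsub>M\<^esub> y') = z"
          proof -
            have "(y \<oplus>\<^bsub>M\<^esub> \<ominus>\<^bsub>M\<^esub> y') \<oplus>\<^bsub>M\<^esub> (r \<odot>\<^bsub>M\<^esub> s \<oplus>\<^bsub>M\<^esub> y') = (y' \<oplus>\<^bsub>M\<^esub> \<ominus>\<^bsub>M\<^esub> y') \<oplus>\<^bsub>M\<^esub> (r \<odot>\<^bsub>M\<^esub> s \<oplus>\<^bsub>M\<^esub> y)"
              using yc rs by (simp add: M.a_ac del: M.r_neg1 M.r_neg2 M.r_neg)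
            then show ?thesis
              using yc rs by (simp add: M.r_neg ry(3))
          qed
          ultimately show "z \<in> N l \<inter> T'"
            using z by simp
        qed
      qed
      then show ?thesis
        by blast
    qed
    ultimately show ?case
      by blast
  qed
  obtain S where S: "finite S" "S \<subseteq> carrier M" and gen: "\<And>N. submodule N A M \<and> S \<subseteq> N \<Longrightarrow> N = carrier M"
    using fg unfolding finitely_generated_def by metis
  obtain T where "S \<subseteq> T" "submodule T A M"
    and stat: "\<And>N :: nat \<Rightarrow> 'm set. (\<forall>k. submodule (N k) A M \<and> N (Suc k) \<subseteq> N k) \<Longrightarrow>
        (\<exists>k. \<forall>l\<ge>k. N l \<inter> T = N k \<inter> T)"
    using *[OF S] by auto
  then have T: "T = carrier M"
    using gen by blast
  have "\<exists>k. \<forall>l\<ge>k. N l = N k" if N: "\<forall>k. submodule (N k) A M \<and> N (Suc k) \<subseteq> N k" for N :: "nat \<Rightarrow> 'm set"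
  proof -
    have "N k \<inter> T = N k" for k
      using N submoduleD(1) T by blast
    then show ?thesis
      using stat[OF N] by simp
  qed
  then show ?thesis
    unfolding submodule_dcc_def by blast
qed

text \<open>Submodules of the regular \<open>R\<close>-module are ideals, by commutativity, so
  \<open>R\<close> satisfies the chain condition and so does the finitely generated
  \<open>R\<close>-module \<open>A\<close>. A left ideal of \<open>A\<close> is an
  \<open>R\<close>-submodule because \<open>r\<close> acts as left multiplication by the element
  \<open>r 1\<close> of \<open>A\<close>.\<close>

lemma (in artin_algebra) submodule_dcc_regular: "submodule_dcc A (regular_module A)"
proof -
  have RA: "left_module R A"
    by (intro left_module.intro left_module_axioms.intro R.ring_axioms abelian_group_axioms)
      (auto simp: smult_l_distr smult_r_distr smult_assoc1)
  interpret R_reg: left_module R "regular_module R"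
    by (rule left_module_regular) (rule R.ring_axioms)
  interpret A_reg: left_module A "regular_module A"
    by (rule left_module_regular) (rule A.ring_axioms)
  have "ideal I R" if I: "submodule I R (regular_module R)" for I
  proof (rule idealI)
    show "ring R" by (rule R.ring_axioms)
    show "subgroup I (add_monoid R)"
      using R_reg.submoduleD[OF I] by (intro subgroup.intro) (auto simp: a_inv_def m_inv_def)
    show "x \<otimes>\<^bsub>R\<^esub> a \<in> I" "a \<otimes>\<^bsub>R\<^esub> x \<in> I" if "a \<in> I" "x \<in> carrier R" for a x
      using R_reg.submoduleD(5)[OF I, of x a] R_reg.submoduleD(1)[OF I] that R.m_comm[of x a] by auto
  qed
  then have "submodule_dcc R (regular_module R)"
    unfolding submodule_dcc_def using ideal_dcc by meson
  then have dcc: "submodule_dcc R A"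
    using left_module.submodule_dcc_finitely_generated[OF RA] finitely_generated by blast
  have "submodule N R A" if N: "submodule N A (regular_module A)" for N
  proof (rule left_module.submoduleI[OF RA])
    note D = A_reg.submoduleD[OF N]
    show "N \<subseteq> carrier A" "\<zero>\<^bsub>A\<^esub> \<in> N" "\<And>x y. \<lbrakk>x \<in> N; y \<in> N\<rbrakk> \<Longrightarrow> x \<oplus>\<^bsub>A\<^esub> y \<in> N"
      using D by auto
    fix a x assume a: "a \<in> carrier R" "x \<in> N"
    then have "a \<odot>\<^bsub>A\<^esub> x = (a \<odot>\<^bsub>A\<^esub> \<one>\<^bsub>A\<^esub>) \<otimes>\<^bsub>A\<^esub> x"
      using D(1) by (subst smult_mult_left) auto
    then show "a \<odot>\<^bsub>A\<^esub> x \<in> N"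
      using a D(5)[of "a \<odot>\<^bsub>A\<^esub> \<one>\<^bsub>A\<^esub>" x] by simp
  qed
  then show ?thesis
    using dcc unfolding submodule_dcc_def by blast
qed

section \<open>Summands cut out by idempotents\<close>

lemma module_homI:
  assumes "\<And>x. x \<in> carrier M \<Longrightarrow> f x \<in> carrier N"
    and "\<And>x y. \<lbrakk>x \<in> carrier M; y \<in> carrier M\<rbrakk> \<Longrightarrow> f (x \<oplus>\<^bsub>M\<^esub> y) = f x \<oplus>\<^bsub>N\<^esub> f y"
    and "\<And>a x. \<lbrakk>a \<in> carrier A; x \<in> carrier M\<rbrakk> \<Longrightarrow> f (a \<odot>\<^bsub>M\<^esub> x) = a \<odot>\<^bsub>N\<^esub> f x"
  shows "f \<in> module_hom A M N"
  using assms by (auto simp: module_hom_def)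

lemma module_homD:
  assumes "f \<in> module_hom A M N"
  shows "x \<in> carrier M \<Longrightarrow> f x \<in> carrier N"
    and "\<lbrakk>x \<in> carrier M; y \<in> carrier M\<rbrakk> \<Longrightarrow> f (x \<oplus>\<^bsub>M\<^esub> y) = f x \<oplus>\<^bsub>N\<^esub> f y"
    and "\<lbrakk>a \<in> carrier A; x \<in> carrier M\<rbrakk> \<Longrightarrow> f (a \<odot>\<^bsub>M\<^esub> x) = a \<odot>\<^bsub>N\<^esub> f x"
  using assms by (auto simp: module_hom_def)

lemma module_hom_comp:
  assumes "f \<in> module_hom A L M" "g \<in> module_hom A M N"
  shows "(\<lambda>x. g (f x)) \<in> module_hom A L N"
  by (rule module_homI) (simp_all add: module_homD[OF assms(1)] module_homD[OF assms(2)])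

lemma module_hom_zero:
  assumes "f \<in> module_hom A M N" "left_module A M" "left_module A N"
  shows "f \<zero>\<^bsub>M\<^esub> = \<zero>\<^bsub>N\<^esub>"
proof -
  interpret M: left_module A M by fact
  interpret N: left_module A N by fact
  have "f (\<zero>\<^bsub>A\<^esub> \<odot>\<^bsub>M\<^esub> \<zero>\<^bsub>M\<^esub>) = \<zero>\<^bsub>A\<^esub> \<odot>\<^bsub>N\<^esub> f \<zero>\<^bsub>M\<^esub>"
    by (intro module_homD(3)[OF assms(1)]) auto
  then show ?thesis
    using module_homD(1)[OF assms(1), of "\<zero>\<^bsub>M\<^esub>"] by simp
qed

lemma module_hom_minus:
  assumes "f \<in> module_hom A M N" "left_module A M" "left_module A N" "x \<in> carrier M"
  shows "f (\<ominus>\<^bsub>M\<^esub> x) = \<ominus>\<^bsub>N\<^esub> f x"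
proof -
  interpret M: left_module A M by fact
  interpret N: left_module A N by fact
  have "f ((\<ominus>\<^bsub>A\<^esub> \<one>\<^bsub>A\<^esub>) \<odot>\<^bsub>M\<^esub> x) = (\<ominus>\<^bsub>A\<^esub> \<one>\<^bsub>A\<^esub>) \<odot>\<^bsub>N\<^esub> f x"
    using assms(4) by (intro module_homD(3)[OF assms(1)]) auto
  then show ?thesis
    using module_homD(1)[OF assms(1)] assms(4) by (simp add: M.smult_minus_one N.smult_minus_one)
qed

lemma submodule_vimage:
  assumes f: "f \<in> module_hom A M N" and M: "left_module A M" and N: "left_module A N"
    and H: "submodule H A N"
  shows "submodule {x \<in> carrier M. f x \<in> H} A M"
proof -
  interpret M: left_module A M by fact
  interpret N: left_module A N by fact
  show ?thesis
    by (rule M.submoduleI)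
      (auto simp: module_homD[OF f] module_hom_zero[OF f M N] N.submoduleD[OF H])
qed

lemma submodule_image:
  assumes f: "f \<in> module_hom A M N" and M: "left_module A M" and N: "left_module A N"
  shows "submodule (f ` carrier M) A N"
proof -
  interpret M: left_module A M by fact
  interpret N: left_module A N by fact
  show ?thesis
  proof (rule N.submoduleI)
    show "\<zero>\<^bsub>N\<^esub> \<in> f ` carrier M"
      using module_hom_zero[OF f M N] by force
    show "x \<oplus>\<^bsub>N\<^esub> y \<in> f ` carrier M" if xy: "x \<in> f ` carrier M" "y \<in> f ` carrier M" for x y
    proof -
      obtain u v where "x = f u" "y = f v" "u \<in> carrier M" "v \<in> carrier M"
        using xy by blast
      then show ?thesis
        using module_homD(2)[OF f, of u v] by (auto intro!: image_eqI[of _ _ "u \<oplus>\<^bsub>M\<^esub> v"])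
    qed
    show "a \<odot>\<^bsub>N\<^esub> x \<in> f ` carrier M" if ax: "a \<in> carrier A" "x \<in> f ` carrier M" for a x
    proof -
      obtain u where "x = f u" "u \<in> carrier M"
        using ax by blast
      then show ?thesis
        using module_homD(3)[OF f, of a u] ax by (auto intro!: image_eqI[of _ _ "a \<odot>\<^bsub>M\<^esub> u"])
    qed
  qed (use module_homD(1)[OF f] in auto)
qed

text \<open>The image is a retract of \<open>P\<close>, so generators and liftings can be
  transported along \<open>e\<close>. Since it keeps the carrier type of \<open>P\<close>, the
  lifting problems for the image range over the same types as those for \<open>P\<close>.\<close>

lemma idempotent_image_proj:
  fixes P :: "('a, 'm) module"
  assumes P: "P \<in> proj A" and e: "e \<in> module_hom A P P"
    and idem: "\<And>x. x \<in> carrier P \<Longrightarrow> e (e x) = e x"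
  shows "P\<lparr>carrier := e ` carrier P\<rparr> \<in> proj A" (is "?Q \<in> _")
proof -
  have lm: "left_module A P" and fg: "finitely_generated A P" and pr: "projective_module A P"
    using P by (auto simp: proj_def)
  interpret P: left_module A P by (rule lm)
  have sub: "submodule (e ` carrier P) A P"
    using submodule_image[OF e lm lm] .
  have lmQ: "left_module A ?Q"
    by (rule P.left_module_submodule[OF sub])
  interpret Q: left_module A ?Q by (rule lmQ)
  have ec: "e x \<in> carrier P" if "x \<in> carrier P" for x
    using module_homD(1)[OF e that] .
  have eQ: "e \<in> module_hom A P ?Q"
    by (rule module_homI) (auto simp: module_homD[OF e])
  have "finitely_generated A ?Q"
  proof -
    obtain S where S: "finite S" "S \<subseteq> carrier P"
      and gen: "\<And>N. submodule N A P \<and> S \<subseteq> N \<Longrightarrow> N = carrier P"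
      using fg unfolding finitely_generated_def by metis
    have "N = carrier ?Q" if N: "submodule N A ?Q" "e ` S \<subseteq> N" for N
    proof
      show "N \<subseteq> carrier ?Q"
        using Q.submoduleD(1)[OF N(1)] .
      \<comment> \<open>The preimage of \<open>N\<close> under \<open>e\<close> is a submodule
        containing the generators \<open>S\<close>, hence all of \<open>P\<close>.\<close>
      have "{x \<in> carrier P. e x \<in> N} = carrier P"
        using N S by (intro gen conjI submodule_vimage[OF eQ lm lmQ]) auto
      then show "carrier ?Q \<subseteq> N"
        by auto
    qed
    then show ?thesis
      unfolding finitely_generated_def using S by (intro exI[of _ "e ` S"]) auto
  qed
  moreover have "projective_module A ?Q"
    unfolding projective_module_def
  proof (intro conjI allI impI lmQ)
    fix L :: "('a, nat \<Rightarrow> 'a) module" and N :: "('a, 'm) module" and g f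
    assume a: "left_module A L \<and> left_module A N \<and> g \<in> module_hom A L N \<and>
      g ` carrier L = carrier N \<and> f \<in> module_hom A ?Q N"
    \<comment> \<open>Precomposing with \<open>e\<close> extends \<open>f\<close> to all of
      \<open>P\<close>. A lift of this extension, restricted to the image, lifts \<open>f\<close>,
      because \<open>e\<close> is the identity there.\<close>
    then have "(\<lambda>x. f (e x)) \<in> module_hom A P N"
      using module_hom_comp[OF eQ] by blast
    with a obtain h where h: "h \<in> module_hom A P L" "\<And>x. x \<in> carrier P \<Longrightarrow> g (h x) = f (e x)"
      using pr unfolding projective_module_def by metis
    show "\<exists>h\<in>module_hom A ?Q L. \<forall>x\<in>carrier ?Q. g (h x) = f x"
    proof (intro bexI ballI)
      show "h \<in> module_hom A ?Q L"
        by (rule module_homI) (auto simp: module_homD[OF h(1)] ec)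
      show "g (h x) = f x" if "x \<in> carrier ?Q" for x
        using that h(2) ec idem by auto
    qed
  qed
  ultimately show ?thesis
    using lmQ by (simp add: proj_def)
qed

text \<open>The image of the zero idempotent; \<open>hard_trunc\<close> puts this module into the
  degrees that it removes.\<close>

lemma zero_image_proj:
  assumes "P \<in> proj A"
  shows "P\<lparr>carrier := {\<zero>\<^bsub>P\<^esub>}\<rparr> \<in> proj A"
proof -
  interpret left_module A P using assms by (simp add: proj_def)
  have "P\<lparr>carrier := (\<lambda>_. \<zero>\<^bsub>P\<^esub>) ` carrier P\<rparr> \<in> proj A"
    using assms by (rule idempotent_image_proj) (auto intro: module_homI)
  moreover have "(\<lambda>_. \<zero>\<^bsub>P\<^esub>) ` carrier P = {\<zero>\<^bsub>P\<^esub>}"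
    by auto
  ultimately show ?thesis
    by simp
qed

section \<open>Direct sums, complexes and chain maps\<close>

lemma module_sum_simps [simp]:
  "carrier (module_sum M N) = carrier M \<times> carrier N"
  "\<zero>\<^bsub>module_sum M N\<^esub> = (\<zero>\<^bsub>M\<^esub>, \<zero>\<^bsub>N\<^esub>)"
  "(x, y) \<oplus>\<^bsub>module_sum M N\<^esub> (x', y') = (x \<oplus>\<^bsub>M\<^esub> x', y \<oplus>\<^bsub>N\<^esub> y')"
  "a \<odot>\<^bsub>module_sum M N\<^esub> (x, y) = (a \<odot>\<^bsub>M\<^esub> x, a \<odot>\<^bsub>N\<^esub> y)"
  by (simp_all add: module_sum_def)

lemma complex_sum_simps [simp]:
  "obj (complex_sum X Y) i = module_sum (obj X i) (obj Y i)"
  "\<lbrakk>x \<in> carrier (obj X i); y \<in> carrier (obj Y i)\<rbrakk> \<Longrightarrow>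
    diff (complex_sum X Y) i (x, y) = (diff X i x, diff Y i y)"
  by (simp_all add: complex_sum_def)

lemma cochain_complexD:
  assumes "cochain_complex A X"
  shows "left_module A (obj X i)"
    and "diff X i \<in> module_hom A (obj X i) (obj X (i + 1))"
    and "diff X i \<in> extensional (carrier (obj X i))"
    and "x \<in> carrier (obj X i) \<Longrightarrow> diff X (i + 1) (diff X i x) = \<zero>\<^bsub>obj X (i + 2)\<^esub>"
    and "diff X i \<zero>\<^bsub>obj X i\<^esub> = \<zero>\<^bsub>obj X (i + 1)\<^esub>"
    and "x \<in> carrier (obj X i) \<Longrightarrow> diff X i x \<in> carrier (obj X (i + 1))"
proof -
  show 1: "left_module A (obj X i)" "diff X i \<in> module_hom A (obj X i) (obj X (i + 1))"
    "diff X i \<in> extensional (carrier (obj X i))"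
    "x \<in> carrier (obj X i) \<Longrightarrow> diff X (i + 1) (diff X i x) = \<zero>\<^bsub>obj X (i + 2)\<^esub>" for i
    using assms by (auto simp: cochain_complex_def)
  show "diff X i \<zero>\<^bsub>obj X i\<^esub> = \<zero>\<^bsub>obj X (i + 1)\<^esub>"
    using module_hom_zero[OF 1(2) 1(1) 1(1)] .
  show "x \<in> carrier (obj X i) \<Longrightarrow> diff X i x \<in> carrier (obj X (i + 1))"
    using module_homD(1)[OF 1(2)] .
qed

lemma C_projD:
  assumes "X \<in> C_proj A m n"
  shows "cochain_complex A X" "obj X i \<in> proj A" "i \<notin> {m..n} \<Longrightarrow> zero_module (obj X i)"
  using assms by (auto simp: C_proj_def)

lemma chain_mapI:
  assumes "\<And>i. f i \<in> module_hom A (obj X i) (obj Y i)"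
    and "\<And>i x. x \<in> carrier (obj X i) \<Longrightarrow> f (i + 1) (diff X i x) = diff Y i (f i x)"
  shows "f \<in> chain_map A X Y"
  using assms by (auto simp: chain_map_def)

lemma chain_mapD:
  assumes "f \<in> chain_map A X Y"
  shows "f i \<in> module_hom A (obj X i) (obj Y i)"
    and "x \<in> carrier (obj X i) \<Longrightarrow> f (i + 1) (diff X i x) = diff Y i (f i x)"
    and "x \<in> carrier (obj X i) \<Longrightarrow> f i x \<in> carrier (obj Y i)"
  using assms by (auto simp: chain_map_def module_hom_def)

lemma chain_map_comp:
  assumes f: "f \<in> chain_map A X Y" and g: "g \<in> chain_map A Y Z"
  shows "(\<lambda>i x. g i (f i x)) \<in> chain_map A X Z"
  by (rule chain_mapI)
    (auto intro: module_hom_comp[OF chain_mapD(1)[OF f] chain_mapD(1)[OF g]]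
      simp: chain_mapD(2,3)[OF f] chain_mapD(2)[OF g])

section \<open>Idempotent chain endomorphisms and the splittings they induce\<close>

definition idempotent_map :: "('a, 'e) ring_scheme \<Rightarrow> ('a, 'm) cochain \<Rightarrow> (int \<Rightarrow> 'm \<Rightarrow> 'm) \<Rightarrow> bool" where
  "idempotent_map A X e \<longleftrightarrow>
     e \<in> chain_map A X X \<and> (\<forall>i. \<forall>x\<in>carrier (obj X i). e i (e i x) = e i x)"

text \<open>Only the carriers shrink, while operations and type are those of \<open>X\<close>.
  Restricting the differentials keeps them extensional, as \<open>cochain_complex\<close>
  demands.\<close>

definition image_complex :: "('a, 'm) cochain \<Rightarrow> (int \<Rightarrow> 'm \<Rightarrow> 'm) \<Rightarrow> ('a, 'm) cochain" where
  "image_complex X e =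
     \<lparr>obj = (\<lambda>i. (obj X i)\<lparr>carrier := e i ` carrier (obj X i)\<rparr>),
      diff = (\<lambda>i. restrict (diff X i) (e i ` carrier (obj X i)))\<rparr>"

lemma image_complex_simps [simp]:
  "obj (image_complex X e) i = (obj X i)\<lparr>carrier := e i ` carrier (obj X i)\<rparr>"
  "x \<in> e i ` carrier (obj X i) \<Longrightarrow> diff (image_complex X e) i x = diff X i x"
  by (simp_all add: image_complex_def)

text \<open>As \<open>e\<close> commutes with the differential, \<open>d (e u) = e (d u)\<close>, so
  the images form a subcomplex; projectivity in each degree comes from
  \<open>idempotent_image_proj\<close>.\<close>

lemma image_complex_C_proj:
  assumes X: "X \<in> C_proj A m n" and e: "idempotent_map A X e"
  shows "image_complex X e \<in> C_proj A m n"
proof -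
  have cX: "cochain_complex A X" using C_projD(1)[OF X] .
  note X' = cochain_complexD[OF cX]
  have e': "e \<in> chain_map A X X" "\<And>i x. x \<in> carrier (obj X i) \<Longrightarrow> e i (e i x) = e i x"
    using e by (auto simp: idempotent_map_def)
  note e1 = chain_mapD[OF e'(1)]
  have pr: "obj (image_complex X e) i \<in> proj A" for i
    using idempotent_image_proj[OF C_projD(2)[OF X] e1(1) e'(2)] by simp
  moreover have "zero_module (obj (image_complex X e) i)" if "i \<notin> {m..n}" for i
    using C_projD(3)[OF X that] module_hom_zero[OF e1(1) X'(1) X'(1)] by (simp add: zero_module_def)
  moreover have d: "diff X i x \<in> e (i + 1) ` carrier (obj X (i + 1))" if "x \<in> e i ` carrier (obj X i)" for i x
  proof -
    obtain u where u: "x = e i u" "u \<in> carrier (obj X i)"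
      using \<open>x \<in> _\<close> by auto
    then have "diff X i x = e (i + 1) (diff X i u)"
      using e1 by simp
    then show ?thesis
      using u X'(6) by auto
  qed
  have ec: "e i ` carrier (obj X i) \<subseteq> carrier (obj X i)" for i
    using e1 by auto
  have "cochain_complex A (image_complex X e)"
    unfolding cochain_complex_def
  proof (intro allI conjI ballI IntI)
    fix i
    show "left_module A (obj (image_complex X e) i)"
      using pr[of i] by (simp add: proj_def)
    show "diff (image_complex X e) i \<in> extensional (carrier (obj (image_complex X e) i))"
      by (simp add: image_complex_def)
    have sub: "submodule (e i ` carrier (obj X i)) A (obj X i)" for i
      by (rule submodule_image[OF e1(1) X'(1) X'(1)])
    note S = left_module.submoduleD[OF X'(1) sub]
    show "diff (image_complex X e) i \<in> module_hom A (obj (image_complex X e) i) (obj (image_complex X e) (i + 1))"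
    proof (rule module_homI)
      fix x y assume xy: "x \<in> carrier (obj (image_complex X e) i)" "y \<in> carrier (obj (image_complex X e) i)"
      have c: "x \<in> e i ` carrier (obj X i)" "y \<in> e i ` carrier (obj X i)" using xy by auto
      have c': "x \<in> carrier (obj X i)" "y \<in> carrier (obj X i)" using c ec by auto
      show "diff (image_complex X e) i (x \<oplus>\<^bsub>obj (image_complex X e) i\<^esub> y) =
        diff (image_complex X e) i x \<oplus>\<^bsub>obj (image_complex X e) (i + 1)\<^esub> diff (image_complex X e) i y"
        using c S(3)[OF c] module_homD(2)[OF X'(2) c'] by simp
    next
      fix a x assume xy: "a \<in> carrier A" "x \<in> carrier (obj (image_complex X e) i)"
      have c: "x \<in> e i ` carrier (obj X i)" using xy by auto
      have c': "x \<in> carrier (obj X i)" using c ec by auto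
      show "diff (image_complex X e) i (a \<odot>\<^bsub>obj (image_complex X e) i\<^esub> x) =
        a \<odot>\<^bsub>obj (image_complex X e) (i + 1)\<^esub> diff (image_complex X e) i x"
        using c S(5)[OF xy(1) c] module_homD(3)[OF X'(2) xy(1) c'] by simp
    qed (use d in auto)
    fix x assume "x \<in> carrier (obj (image_complex X e) i)"
    then have c: "x \<in> e i ` carrier (obj X i)" by auto
    then have c': "x \<in> carrier (obj X i)" using ec by auto
    show "diff (image_complex X e) (i + 1) (diff (image_complex X e) i x) = \<zero>\<^bsub>obj (image_complex X e) (i + 2)\<^esub>"
      using c d[OF c] X'(4)[OF c'] by simp
  qed
  ultimately show ?thesis
    by (simp add: C_proj_def)
qed

lemma idempotent_map_complement:
  assumes X: "cochain_complex A X" and e: "idempotent_map A X e"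
  shows "idempotent_map A X (\<lambda>i x. x \<ominus>\<^bsub>obj X i\<^esub> e i x)"
proof -
  note X' = cochain_complexD[OF X]
  have e': "e \<in> chain_map A X X" "\<And>i x. x \<in> carrier (obj X i) \<Longrightarrow> e i (e i x) = e i x"
    using e by (auto simp: idempotent_map_def)
  note e1 = chain_mapD[OF e'(1)]
  have "(\<lambda>i x. x \<ominus>\<^bsub>obj X i\<^esub> e i x) \<in> chain_map A X X"
  proof (rule chain_mapI)
    fix i
    interpret left_module A "obj X i" by (rule X')
    interpret S: left_module A "obj X (i + 1)" by (rule X')
    show "(\<lambda>x. x \<ominus>\<^bsub>obj X i\<^esub> e i x) \<in> module_hom A (obj X i) (obj X i)"
      by (rule module_homI)
        (auto simp: e1(3) module_homD[OF e1(1)] a_minus_def M.minus_add M.a_ac smult_r_distr smult_r_minus)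
    fix x assume "x \<in> carrier (obj X i)"
    then show "diff X i x \<ominus>\<^bsub>obj X (i + 1)\<^esub> e (i + 1) (diff X i x) = diff X i (x \<ominus>\<^bsub>obj X i\<^esub> e i x)"
      using e1 module_homD(2)[OF X'(2)] module_hom_minus[OF X'(2) X'(1) X'(1)] by (simp add: a_minus_def)
  qed
  moreover have "(x \<ominus>\<^bsub>obj X i\<^esub> e i x) \<ominus>\<^bsub>obj X i\<^esub> e i (x \<ominus>\<^bsub>obj X i\<^esub> e i x) = x \<ominus>\<^bsub>obj X i\<^esub> e i x"
    if "x \<in> carrier (obj X i)" for i x
  proof -
    interpret left_module A "obj X i" by (rule X')
    have "e i (x \<ominus>\<^bsub>obj X i\<^esub> e i x) = \<zero>\<^bsub>obj X i\<^esub>"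
      using that e1(3) e'(2) module_homD(2)[OF e1(1)] module_hom_minus[OF e1(1) X'(1) X'(1)]
      by (simp add: a_minus_def M.r_neg)
    then show ?thesis
      using that e1(3) by (simp add: a_minus_def)
  qed
  ultimately show ?thesis
    by (simp add: idempotent_map_def)
qed

text \<open>With \<open>chain_map_from_image\<close> this factors \<open>e\<close> through its
  image, which is how maps on the image are turned into endomorphisms of \<open>X\<close>.\<close>

lemma chain_map_to_image:
  assumes e: "idempotent_map A X e"
  shows "e \<in> chain_map A X (image_complex X e)"
proof -
  have "e \<in> chain_map A X X" using e by (simp add: idempotent_map_def)
  note e1 = chain_mapD[OF this]
  show ?thesis
    by (rule chain_mapI) (auto simp: e1 module_homD[OF e1(1)] intro!: module_homI)
qed

lemma chain_map_from_image:
  assumes e: "idempotent_map A X e"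
  shows "(\<lambda>i x. x) \<in> chain_map A (image_complex X e) X"
proof -
  have "e \<in> chain_map A X X" using e by (simp add: idempotent_map_def)
  note e1 = chain_mapD[OF this]
  show ?thesis
    by (rule chain_mapI) (auto simp: e1 intro!: module_homI)
qed

text \<open>The isomorphism is \<open>x \<mapsto> (e x, x - e x)\<close>, with addition as its
  inverse. They are mutually inverse because \<open>e\<close> and \<open>1 - e\<close> are
  idempotent, annihilate each other and add up to the identity.\<close>

lemma complex_iso_sum_images:
  assumes X: "cochain_complex A X" and e: "idempotent_map A X e"
  shows "complex_iso A X
    (complex_sum (image_complex X e) (image_complex X (\<lambda>i x. x \<ominus>\<^bsub>obj X i\<^esub> e i x)))"
proof -
  define c where "c = (\<lambda>i x. x \<ominus>\<^bsub>obj X i\<^esub> e i x)"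
  note X' = cochain_complexD[OF X]
  have c: "idempotent_map A X c"
    using idempotent_map_complement[OF X e] by (simp add: c_def)
  have e': "e \<in> chain_map A X X" "\<And>i x. x \<in> carrier (obj X i) \<Longrightarrow> e i (e i x) = e i x"
    using e by (auto simp: idempotent_map_def)
  have c': "c \<in> chain_map A X X" "\<And>i x. x \<in> carrier (obj X i) \<Longrightarrow> c i (c i x) = c i x"
    using c by (auto simp: idempotent_map_def)
  note e1 = chain_mapD[OF e'(1)] and c1 = chain_mapD[OF c'(1)]
  note e2 = chain_mapD[OF chain_map_to_image[OF e]] and c2 = chain_mapD[OF chain_map_to_image[OF c]]
  let ?S = "complex_sum (image_complex X e) (image_complex X c)"
  have dec: "e i x \<oplus>\<^bsub>obj X i\<^esub> c i x = x" and ce: "c i (e i x) = \<zero>\<^bsub>obj X i\<^esub>" and ec: "e i (c i x) = \<zero>\<^bsub>obj X i\<^esub>"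
    if x: "x \<in> carrier (obj X i)" for i x
  proof -
    interpret left_module A "obj X i" by (rule X')
    have "e i x \<oplus>\<^bsub>obj X i\<^esub> c i x = x \<oplus>\<^bsub>obj X i\<^esub> (e i x \<oplus>\<^bsub>obj X i\<^esub> \<ominus>\<^bsub>obj X i\<^esub> e i x)"
      using x e1 by (simp add: c_def a_minus_def M.a_ac del: M.r_neg M.r_neg1 M.r_neg2)
    then show "e i x \<oplus>\<^bsub>obj X i\<^esub> c i x = x"
      using x e1 by (simp add: M.r_neg)
    show "c i (e i x) = \<zero>\<^bsub>obj X i\<^esub>"
      using x e1 e'(2) by (simp add: c_def a_minus_def M.r_neg)
    show "e i (c i x) = \<zero>\<^bsub>obj X i\<^esub>"
      using x e1(3) e'(2) module_homD(2)[OF e1(1)] module_hom_minus[OF e1(1) X'(1) X'(1)]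
      by (simp add: c_def a_minus_def M.r_neg)
  qed
  have f: "(\<lambda>i x. (e i x, c i x)) \<in> chain_map A X ?S"
  proof (rule chain_mapI)
    show "(\<lambda>x. (e i x, c i x)) \<in> module_hom A (obj X i) (obj ?S i)" for i
      by (rule module_homI) (auto simp: module_homD[OF e1(1)] module_homD[OF c1(1)])
    show "(e (i + 1) (diff X i x), c (i + 1) (diff X i x)) = diff ?S i (e i x, c i x)"
      if "x \<in> carrier (obj X i)" for i x
      using that e1(2) c1(2) by simp
  qed
  have g: "(\<lambda>i (x, y). x \<oplus>\<^bsub>obj X i\<^esub> y) \<in> chain_map A ?S X"
  proof (rule chain_mapI)
    fix i
    interpret left_module A "obj X i" by (rule X')
    have cc: "e i x \<in> carrier (obj X i)" "c i x \<in> carrier (obj X i)" if "x \<in> carrier (obj X i)" for x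
      using that e1 c1 by auto
    show "(\<lambda>(x, y). x \<oplus>\<^bsub>obj X i\<^esub> y) \<in> module_hom A (obj ?S i) (obj X i)"
      by (rule module_homI) (auto simp: cc M.a_ac smult_r_distr)
    show "(case diff ?S i x of (x, y) \<Rightarrow> x \<oplus>\<^bsub>obj X (i + 1)\<^esub> y) = diff X i (case x of (x, y) \<Rightarrow> x \<oplus>\<^bsub>obj X i\<^esub> y)"
      if "x \<in> carrier (obj ?S i)" for x
      using that by (auto simp: cc module_homD(2)[OF X'(2)])
  qed
  have "complex_iso A X ?S"
    unfolding complex_iso_def
  proof (rule bexI[OF _ f], rule bexI[OF _ g], intro allI conjI ballI)
    fix i
    interpret left_module A "obj X i" by (rule X')
    show "(case (e i x, c i x) of (x, y) \<Rightarrow> x \<oplus>\<^bsub>obj X i\<^esub> y) = x" if "x \<in> carrier (obj X i)" for x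
      using dec that by simp
    fix y assume "y \<in> carrier (obj ?S i)"
    then obtain u v where y: "y = (e i u, c i v)" and uv: "u \<in> carrier (obj X i)" "v \<in> carrier (obj X i)"
      by auto
    then show "(e i (case y of (x, y) \<Rightarrow> x \<oplus>\<^bsub>obj X i\<^esub> y), c i (case y of (x, y) \<Rightarrow> x \<oplus>\<^bsub>obj X i\<^esub> y)) = y"
      using e1(3) c1(3) e'(2) c'(2) ec ce by (simp add: module_homD(2)[OF e1(1)] module_homD(2)[OF c1(1)])
  qed
  then show ?thesis
    by (simp add: c_def)
qed

lemma zero_complex_image:
  assumes "cochain_complex A X" "idempotent_map A X e"
  shows "zero_complex (image_complex X e) \<longleftrightarrow> (\<forall>i. \<forall>x\<in>carrier (obj X i). e i x = \<zero>\<^bsub>obj X i\<^esub>)"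
proof -
  have "e i \<zero>\<^bsub>obj X i\<^esub> = \<zero>\<^bsub>obj X i\<^esub>" "\<zero>\<^bsub>obj X i\<^esub> \<in> carrier (obj X i)" for i
  proof -
    note X' = cochain_complexD(1)[OF assms(1)]
    have "e \<in> chain_map A X X" using assms by (simp add: idempotent_map_def)
    then show "e i \<zero>\<^bsub>obj X i\<^esub> = \<zero>\<^bsub>obj X i\<^esub>"
      using module_hom_zero[OF chain_mapD(1) X' X'] by blast
    interpret left_module A "obj X i" by (rule X')
    show "\<zero>\<^bsub>obj X i\<^esub> \<in> carrier (obj X i)" by simp
  qed
  then have "e i ` carrier (obj X i) = {\<zero>\<^bsub>obj X i\<^esub>} \<longleftrightarrow> (\<forall>x\<in>carrier (obj X i). e i x = \<zero>\<^bsub>obj X i\<^esub>)" for i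
    by force
  then show ?thesis
    by (simp add: zero_complex_def zero_module_def)
qed

section \<open>Descent to an indecomposable summand\<close>

text \<open>A nontrivial decomposition of the image as \<open>Y\<close> plus \<open>W\<close> gives
  a projection onto the part coming from \<open>Y\<close>. Viewed as an endomorphism of
  \<open>X\<close>, it is nonzero since \<open>Y\<close> is nonzero, and its image is strictly
  smaller since \<open>W\<close> is nonzero.\<close>

lemma smaller_idempotent:
  fixes X :: "('a, 'm) cochain"
  assumes X: "X \<in> C_proj A m n" and e: "idempotent_map A X e"
    and nz: "\<not> zero_complex (image_complex X e)"
    and dec: "\<not> indecomposable_in A (C_proj A m n) (image_complex X e)"
  shows "\<exists>e'. idempotent_map A X e' \<and> \<not> zero_complex (image_complex X e') \<and>
    (\<forall>i. e' i ` carrier (obj X i) \<subseteq> e i ` carrier (obj X i)) \<and>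
    (\<exists>i. e' i ` carrier (obj X i) \<noteq> e i ` carrier (obj X i))"
proof -
  have cX: "cochain_complex A X" using C_projD(1)[OF X] .
  let ?I = "image_complex X e"
  obtain Y W :: "('a, 'm) cochain" where Y: "Y \<in> C_proj A m n" and W: "W \<in> C_proj A m n"
    and iso: "complex_iso A ?I (complex_sum Y W)" and nzYW: "\<not> zero_complex Y" "\<not> zero_complex W"
    using dec nz image_complex_C_proj[OF X e] unfolding indecomposable_in_def by blast
  let ?S = "complex_sum Y W"
  obtain f g where f: "f \<in> chain_map A ?I ?S" and g: "g \<in> chain_map A ?S ?I"
    and "\<forall>i. \<forall>z\<in>carrier (obj ?S i). f i (g i z) = z"
    using iso unfolding complex_iso_def by blast
  then have fg: "f i (g i (y, w)) = (y, w)" if "y \<in> carrier (obj Y i)" "w \<in> carrier (obj W i)" for i y w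
    using that by simp
  note Y' = cochain_complexD[OF C_projD(1)[OF Y]] and W' = cochain_complexD[OF C_projD(1)[OF W]]
  note X' = cochain_complexD[OF cX]
  note I' = cochain_complexD[OF C_projD(1)[OF image_complex_C_proj[OF X e]]]
  have ee: "e \<in> chain_map A X X" "\<And>i x. x \<in> carrier (obj X i) \<Longrightarrow> e i (e i x) = e i x"
    using e by (auto simp: idempotent_map_def)
  have zW: "\<zero>\<^bsub>obj W i\<^esub> \<in> carrier (obj W i)" and zY: "\<zero>\<^bsub>obj Y i\<^esub> \<in> carrier (obj Y i)" for i
    using W'(1) Y'(1) by (simp_all add: left_module_def abelian_group_def abelian_monoid.zero_closed)
  define p where "p i yw = (fst yw, \<zero>\<^bsub>obj W i\<^esub>)" for i and yw :: "'m \<times> 'm"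
  have p: "p \<in> chain_map A ?S ?S"
  proof (rule chain_mapI)
    fix i
    interpret W: left_module A "obj W i" by (rule W')
    show "p i \<in> module_hom A (obj ?S i) (obj ?S i)"
      by (rule module_homI) (auto simp: p_def)
    show "p (i + 1) (diff ?S i x) = diff ?S i (p i x)" if "x \<in> carrier (obj ?S i)" for x
      using that by (auto simp: p_def W'(5))
  qed
  \<comment> \<open>Project \<open>X\<close> to the image of \<open>e\<close>, pass to the sum, kill
    the component in \<open>W\<close>, and return. Idempotency rests on \<open>f\<close> undoing
    \<open>g\<close> on the sum.\<close>
  define e' where "e' i x = g i (p i (f i (e i x)))" for i x
  have e'X: "e' \<in> chain_map A X X"
    unfolding e'_def
    using chain_map_comp[OF chain_map_comp[OF chain_map_comp[OF chain_map_comp[OF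
          chain_map_to_image[OF e] f] p] g] chain_map_from_image[OF e]] by simp
  have pfe: "\<exists>y\<in>carrier (obj Y i). p i (f i (e i x)) = (y, \<zero>\<^bsub>obj W i\<^esub>)" if "x \<in> carrier (obj X i)" for i x
    using chain_mapD(3)[OF f, of "e i x" i] that by (auto simp: p_def)
  have sub: "e' i x \<in> e i ` carrier (obj X i)" if "x \<in> carrier (obj X i)" for i x
    using pfe[OF that] chain_mapD(3)[OF g, of _ i] zW by (auto simp: e'_def)
  have e_fix: "e i u = u" if "u \<in> e i ` carrier (obj X i)" for i u
    using that ee by auto
  have "e' i (e' i x) = e' i x" if x: "x \<in> carrier (obj X i)" for i x
  proof -
    obtain y where y: "y \<in> carrier (obj Y i)" "p i (f i (e i x)) = (y, \<zero>\<^bsub>obj W i\<^esub>)"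
      using pfe[OF x] by auto
    then have "e' i (e' i x) = g i (p i (f i (g i (y, \<zero>\<^bsub>obj W i\<^esub>))))"
      using e_fix[OF sub[OF x]] by (simp add: e'_def)
    then show ?thesis
      using y fg[OF y(1) zW] by (simp add: e'_def) (simp add: p_def)
  qed
  then have e': "idempotent_map A X e'"
    using e'X by (simp add: idempotent_map_def)
  have gI: "g i (y, w) \<in> e i ` carrier (obj X i)" if "y \<in> carrier (obj Y i)" "w \<in> carrier (obj W i)" for i y w
    using chain_mapD(3)[OF g, of "(y, w)" i] that by simp
  have eX: "u \<in> carrier (obj X i)" if "u \<in> e i ` carrier (obj X i)" for i u
    using that chain_mapD(3)[OF ee(1)] by auto
  have e'g: "e' i (g i (y, w)) = g i (y, \<zero>\<^bsub>obj W i\<^esub>)" if "y \<in> carrier (obj Y i)" "w \<in> carrier (obj W i)" for i y w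
    using e_fix[OF gI[OF that]] fg[OF that] by (simp add: e'_def p_def)
  have "\<not> zero_complex (image_complex X e')"
  proof
    assume "zero_complex (image_complex X e')"
    then have z: "e' i x = \<zero>\<^bsub>obj X i\<^esub>" if "x \<in> carrier (obj X i)" for i x
      using zero_complex_image[OF cX e'] that by blast
    \<comment> \<open>Scaling by the zero of \<open>A\<close> in each component gives this directly,
      without first establishing that \<open>module_sum\<close> is a left module.\<close>
    have f0: "f i \<zero>\<^bsub>obj X i\<^esub> = (\<zero>\<^bsub>obj Y i\<^esub>, \<zero>\<^bsub>obj W i\<^esub>)" for i
    proof -
      have "\<zero>\<^bsub>obj X i\<^esub> \<in> e i ` carrier (obj X i)"
        using module_hom_zero[OF chain_mapD(1)[OF ee(1)] X'(1) X'(1), of i] X'(1)[of i]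
        by (intro image_eqI[of _ _ "\<zero>\<^bsub>obj X i\<^esub>"])
          (simp_all add: left_module_def abelian_group_def abelian_monoid.zero_closed)
      then have "f i \<zero>\<^bsub>obj X i\<^esub> \<in> carrier (obj ?S i)"
        using chain_mapD(3)[OF f, of "\<zero>\<^bsub>obj X i\<^esub>" i] by simp
      then obtain y w where yw: "f i \<zero>\<^bsub>obj X i\<^esub> = (y, w)" "y \<in> carrier (obj Y i)" "w \<in> carrier (obj W i)"
        by auto
      interpret I: left_module A "obj ?I i" by (rule I')
      interpret Y: left_module A "obj Y i" by (rule Y')
      interpret W: left_module A "obj W i" by (rule W')
      have "f i (\<zero>\<^bsub>A\<^esub> \<odot>\<^bsub>obj ?I i\<^esub> \<zero>\<^bsub>obj ?I i\<^esub>) = \<zero>\<^bsub>A\<^esub> \<odot>\<^bsub>obj ?S i\<^esub> f i \<zero>\<^bsub>obj ?I i\<^esub>"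
        by (intro module_homD(3)[OF chain_mapD(1)[OF f]] I.A.zero_closed I.M.zero_closed)
      moreover have "\<zero>\<^bsub>A\<^esub> \<odot>\<^bsub>obj ?I i\<^esub> \<zero>\<^bsub>obj ?I i\<^esub> = \<zero>\<^bsub>obj ?I i\<^esub>"
        by (rule I.smult_l_null) (rule I.M.zero_closed)
      ultimately show ?thesis
        using yw by simp
    qed
    \<comment> \<open>On \<open>g (y, 0)\<close> the map \<open>e'\<close> is the identity, so its
      vanishing forces \<open>g (y, 0) = 0\<close>, and applying \<open>f\<close> gives
      \<open>y = 0\<close>.\<close>
    have "y = \<zero>\<^bsub>obj Y i\<^esub>" if y: "y \<in> carrier (obj Y i)" for i y
    proof -
      have "g i (y, \<zero>\<^bsub>obj W i\<^esub>) = \<zero>\<^bsub>obj X i\<^esub>"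
        using e'g[OF y zW] z[OF eX[OF gI[OF y zW]]] by simp
      then show ?thesis
        using fg[OF y zW] f0 by simp
    qed
    then show False
      using nzYW(1) zY unfolding zero_complex_def zero_module_def by blast
  qed
  moreover have "\<exists>i. e' i ` carrier (obj X i) \<noteq> e i ` carrier (obj X i)"
  proof (rule ccontr)
    assume "\<not> ?thesis"
    then have eq: "e' i ` carrier (obj X i) = e i ` carrier (obj X i)" for i
      by blast
    \<comment> \<open>With equal images, \<open>e'\<close> would fix \<open>g (0, w)\<close>,
      although it sends that element to \<open>g (0, 0)\<close>; injectivity of \<open>g\<close>
      then gives \<open>w = 0\<close>.\<close>
    have "w = \<zero>\<^bsub>obj W i\<^esub>" if w: "w \<in> carrier (obj W i)" for i w
    proof -
      have "g i (\<zero>\<^bsub>obj Y i\<^esub>, w) \<in> e' i ` carrier (obj X i)"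
        using gI[OF zY w] eq by simp
      then have "e' i (g i (\<zero>\<^bsub>obj Y i\<^esub>, w)) = g i (\<zero>\<^bsub>obj Y i\<^esub>, w)"
        using e' by (auto simp: idempotent_map_def)
      then have "g i (\<zero>\<^bsub>obj Y i\<^esub>, w) = g i (\<zero>\<^bsub>obj Y i\<^esub>, \<zero>\<^bsub>obj W i\<^esub>)"
        using e'g[OF zY w] by simp
      then show ?thesis
        using fg[OF zY w] fg[OF zY zW] by simp
    qed
    then show False
      using nzYW(2) zW unfolding zero_complex_def zero_module_def by blast
  qed
  ultimately show ?thesis
    using e' sub by blast
qed

text \<open>If no image were indecomposable, \<open>smaller_idempotent\<close> could be iterated
  forever. In each degree the resulting chain of images becomes stationary, and since only finitely
  many degrees matter, some step would change nothing in any degree.\<close>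

lemma exists_indecomposable_summand:
  fixes X :: "('a, 'm) cochain"
  assumes dcc: "submodule_dcc A (regular_module A)" and X: "X \<in> C_proj A m n" and nz: "\<not> zero_complex X"
  shows "\<exists>Y :: ('a, 'm) cochain.
    indecomposable_in A (C_proj A m n) Y \<and> direct_summand_in A (C_proj A m n) Y X"
proof -
  have cX: "cochain_complex A X" using C_projD(1)[OF X] .
  note X' = cochain_complexD[OF cX]
  define P where "P e \<longleftrightarrow> idempotent_map A X e \<and> \<not> zero_complex (image_complex X e)" for e
  define smaller where "smaller e' e \<longleftrightarrow> (\<forall>i. e' i ` carrier (obj X i) \<subseteq> e i ` carrier (obj X i)) \<and>
    (\<exists>i. e' i ` carrier (obj X i) \<noteq> e i ` carrier (obj X i))" for e' e :: "int \<Rightarrow> 'm \<Rightarrow> 'm"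
  have "\<exists>e. P e \<and> indecomposable_in A (C_proj A m n) (image_complex X e)"
  proof (rule ccontr)
    assume no: "\<not> ?thesis"
    have id: "idempotent_map A X (\<lambda>i x. x)"
      by (auto simp: idempotent_map_def intro!: chain_mapI module_homI)
    \<comment> \<open>The descent starts at the identity, whose image has the same modules as
      \<open>X\<close>.\<close>
    have "P (\<lambda>i x. x)"
      using id nz by (simp add: P_def zero_complex_def)
    moreover have "\<exists>e'. P e' \<and> smaller e' e" if "P e" for e
      using smaller_idempotent[OF X, of e] no that unfolding P_def smaller_def by blast
    ultimately obtain s where s: "\<And>k :: nat. P (s k)" "\<And>k. smaller (s (Suc k)) (s k)"
      using dependent_nat_choice[of "\<lambda>_. P" "\<lambda>_ e e'. smaller e' e"] by metis
    have "\<exists>k. \<forall>l\<ge>k. s l i ` carrier (obj X i) = s k i ` carrier (obj X i)" for i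
    proof -
      have "submodule_dcc A (obj X i)"
        using left_module.submodule_dcc_finitely_generated[OF X'(1) dcc] C_projD(2)[OF X]
        by (simp add: proj_def)
      moreover have "submodule (s k i ` carrier (obj X i)) A (obj X i)" for k
        using s(1)[of k] submodule_image[OF chain_mapD(1) X'(1) X'(1)]
        by (auto simp: P_def idempotent_map_def)
      ultimately show ?thesis
        using s(2) unfolding submodule_dcc_def smaller_def
        by (elim allE[of _ "\<lambda>k. s k i ` carrier (obj X i)"]) blast
    qed
    then obtain K where K: "\<And>i l. l \<ge> K i \<Longrightarrow> s l i ` carrier (obj X i) = s (K i) i ` carrier (obj X i)"
      by metis
    \<comment> \<open>A common stationary index for the degrees in the window; the inserted 0 keeps
      the maximum meaningful for an empty interval.\<close>
    define k where "k = Max (insert 0 (K ` {m..n}))"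
    have "s (Suc k) i ` carrier (obj X i) = s k i ` carrier (obj X i)" for i
    proof (cases "i \<in> {m..n}")
      case True
      then have "K i \<le> k"
        by (auto simp: k_def)
      then show ?thesis
        using K[of i k] K[of i "Suc k"] by simp
    next
      case False
      \<comment> \<open>Outside the window every image complex is zero, so all terms of the chain
        agree from the beginning.\<close>
      have "s l i ` carrier (obj X i) = {\<zero>\<^bsub>obj X i\<^esub>}" for l
        using s(1)[of l] image_complex_C_proj[OF X, of "s l"] C_projD(3)[OF _ False, of "image_complex X (s l)" A]
        by (simp add: P_def zero_module_def)
      then show ?thesis by simp
    qed
    then show False
      using s(2)[of k] by (simp add: smaller_def)
  qed
  then obtain e where e: "idempotent_map A X e" and ind: "indecomposable_in A (C_proj A m n) (image_complex X e)"
    by (auto simp: P_def)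
  moreover have "direct_summand_in A (C_proj A m n) (image_complex X e) X"
    unfolding direct_summand_in_def
    using complex_iso_sum_images[OF cX e] image_complex_C_proj[OF X] idempotent_map_complement[OF cX e] e X
    by blast
  ultimately show ?thesis
    by blast
qed

section \<open>Truncations and shifts\<close>

lemma C_proj_mono:
  assumes "m' \<le> m" "n \<le> n'"
  shows "C_proj A m n \<subseteq> C_proj A m' n'"
  using assms by (auto simp: C_proj_def)

text \<open>Of two consecutive differentials of the truncation, either both come from
  \<open>Z\<close> or at least one is zero, so their composite still vanishes.\<close>

lemma hard_trunc_C_proj:
  assumes Z: "Z \<in> C_proj A m' n'"
  shows "hard_trunc m n Z \<in> C_proj A m n"
proof -
  note Z' = cochain_complexD[OF C_projD(1)[OF Z]]
  let ?T = "hard_trunc m n Z"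
  have o: "obj ?T i = (if i \<in> {m..n} then obj Z i else (obj Z i)\<lparr>carrier := {\<zero>\<^bsub>obj Z i\<^esub>}\<rparr>)" for i
    by (simp add: hard_trunc_def)
  have pr: "obj ?T i \<in> proj A" for i
    using C_projD(2)[OF Z] by (simp add: o zero_image_proj)
  have ops [simp]: "\<zero>\<^bsub>obj ?T i\<^esub> = \<zero>\<^bsub>obj Z i\<^esub>" "add (obj ?T i) = add (obj Z i)" "smult (obj ?T i) = smult (obj Z i)" for i
    by (simp_all add: o)
  have zc: "\<zero>\<^bsub>obj Z i\<^esub> \<in> carrier (obj Z i)" for i
    using Z'(1)[of i] by (simp add: left_module_def abelian_group_def abelian_monoid.zero_closed)
  \<comment> \<open>The inequality \<open>i < n\<close> is strict because the differential leaving
    degree \<open>n\<close> lands in degree \<open>n + 1\<close>, which the truncation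
    kills.\<close>
  have d: "diff ?T i x = (if m \<le> i \<and> i < n then diff Z i x else \<zero>\<^bsub>obj Z (i + 1)\<^esub>)"
    if "x \<in> carrier (obj ?T i)" for i x
    using that by (auto simp: hard_trunc_def)
  have c: "x \<in> carrier (obj Z i)" if "x \<in> carrier (obj ?T i)" for i x
    using that zc by (auto simp: o split: if_splits)
  have zT: "\<zero>\<^bsub>obj Z i\<^esub> \<in> carrier (obj ?T i)" for i
    using zc by (auto simp: o)
  have dc: "diff ?T i x \<in> carrier (obj ?T (i + 1))" if x: "x \<in> carrier (obj ?T i)" for i x
    using d[OF x] zT[of "i + 1"] Z'(6)[OF c[OF x]] by (auto simp: o)
  have "cochain_complex A ?T"
    unfolding cochain_complex_def
  proof (intro allI conjI ballI IntI)
    fix i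
    show lm: "left_module A (obj ?T i)"
      using pr[of i] by (simp add: proj_def)
    show "diff ?T i \<in> extensional (carrier (obj ?T i))"
      using Z'(3) by (auto simp: hard_trunc_def)
    interpret T: left_module A "obj ?T i" by (rule lm)
    interpret S: left_module A "obj Z (i + 1)" by (rule Z')
    show "diff ?T i \<in> module_hom A (obj ?T i) (obj ?T (i + 1))"
    proof (rule module_homI)
      fix x y assume xy: "x \<in> carrier (obj ?T i)" "y \<in> carrier (obj ?T i)"
      show "diff ?T i (x \<oplus>\<^bsub>obj ?T i\<^esub> y) = diff ?T i x \<oplus>\<^bsub>obj ?T (i + 1)\<^esub> diff ?T i y"
        using d[OF T.M.a_closed[OF xy]] d[OF xy(1)] d[OF xy(2)] module_homD(2)[OF Z'(2) c[OF xy(1)] c[OF xy(2)]]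
        by simp
    next
      fix a x assume x: "a \<in> carrier A" "x \<in> carrier (obj ?T i)"
      show "diff ?T i (a \<odot>\<^bsub>obj ?T i\<^esub> x) = a \<odot>\<^bsub>obj ?T (i + 1)\<^esub> diff ?T i x"
        using d[OF T.smult_closed[OF x]] d[OF x(2)] module_homD(3)[OF Z'(2) x(1) c[OF x(2)]] x(1)
        by simp
    qed (rule dc)
    fix x assume x: "x \<in> carrier (obj ?T i)"
    show "diff ?T (i + 1) (diff ?T i x) = \<zero>\<^bsub>obj ?T (i + 2)\<^esub>"
      using d[OF dc[OF x]] d[OF x] Z'(4)[OF c[OF x]] Z'(5)[of "i + 1"] by (simp add: add.assoc)
  qed
  then show ?thesis
    using pr by (simp add: C_proj_def o zero_module_def)
qed

section \<open>Shifts and the transport of decompositions along them\<close>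

lemma shift_simps:
  "obj (shift X k) i = obj X (i + k)"
  "x \<in> carrier (obj X (i + k)) \<Longrightarrow> diff (shift X k) i x =
    (if even k then diff X (i + k) x else \<ominus>\<^bsub>obj X (i + k + 1)\<^esub> diff X (i + k) x)"
  by (simp_all add: shift_def)

lemma shift_C_proj:
  assumes X: "X \<in> C_proj A m n"
  shows "shift X k \<in> C_proj A (m - k) (n - k)"
proof -
  note X' = cochain_complexD[OF C_projD(1)[OF X]]
  have "cochain_complex A (shift X k)"
    unfolding cochain_complex_def
  proof (intro allI conjI ballI IntI)
    fix i
    have [simp]: "i + 1 + k = i + k + 1" "i + 2 + k = i + k + 2"
      by simp_all
    interpret M0: left_module A "obj X (i + k)" by (rule X')
    interpret M1: left_module A "obj X (i + k + 1)" by (rule X')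
    interpret M2: left_module A "obj X (i + k + 2)" by (rule X')
    show "left_module A (obj (shift X k) i)"
      by (simp add: shift_simps X')
    show "diff (shift X k) i \<in> extensional (carrier (obj (shift X k) i))"
      by (simp add: shift_def X')
    show hom: "diff (shift X k) i \<in> module_hom A (obj (shift X k) i) (obj (shift X k) (i + 1))"
      by (rule module_homI)
        (auto simp: shift_simps X'(6) module_homD[OF X'(2)] M1.M.minus_add M1.M.a_ac M1.smult_r_minus)
    fix x assume "x \<in> carrier (obj (shift X k) i)"
    then have x: "x \<in> carrier (obj X (i + k))" by (simp add: shift_simps)
    have dx: "diff X (i + k) x \<in> carrier (obj X (i + k + 1))"
      using X'(6)[OF x] .
    have "diff X (i + k + 1) (\<ominus>\<^bsub>obj X (i + k + 1)\<^esub> diff X (i + k) x) = \<ominus>\<^bsub>obj X (i + k + 2)\<^esub> \<zero>\<^bsub>obj X (i + k + 2)\<^esub>"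
      using module_hom_minus[OF X'(2) X'(1) X'(1) dx] X'(4)[OF x] by (simp add: add.assoc)
    moreover have "diff (shift X k) (i + 1) y =
        (if even k then diff X (i + k + 1) y else \<ominus>\<^bsub>obj X (i + k + 2)\<^esub> diff X (i + k + 1) y)"
      if "y \<in> carrier (obj X (i + k + 1))" for y
      using shift_simps(2)[of y X "i + 1" k] that by (simp add: add.commute add.left_commute)
    ultimately show "diff (shift X k) (i + 1) (diff (shift X k) i x) = \<zero>\<^bsub>obj (shift X k) (i + 2)\<^esub>"
      using x dx X'(4)[OF x] by (simp add: shift_simps(1) shift_simps(2)[OF x])
  qed
  moreover have "zero_module (obj X (i + k))" if "i \<notin> {m - k..n - k}" for i
    using C_projD(3)[OF X, of "i + k"] that by auto
  ultimately show ?thesis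
    using C_projD(2)[OF X] by (simp add: C_proj_def shift_simps)
qed

lemma zero_complex_shift [simp]: "zero_complex (shift X k) \<longleftrightarrow> zero_complex X"
proof -
  have "(\<forall>i. zero_module (obj X (i + k))) \<longleftrightarrow> (\<forall>i. zero_module (obj X i))"
    by (metis diff_add_cancel)
  then show ?thesis
    by (simp add: zero_complex_def shift_simps)
qed

text \<open>The signs cancel because \<open>k\<close> and \<open>- k\<close> have the same parity.
  Equality, rather than mere isomorphism, is possible because differentials are extensional; it
  yields the literal equation \<open>Z = shift X k\<close> in the end.\<close>

lemma shift_shift_inverse:
  assumes "cochain_complex A X"
  shows "shift (shift X k) (- k) = X"
proof -
  note X' = cochain_complexD[OF assms]
  have "diff (shift (shift X k) (- k)) i = diff X i" for i
  proof (rule extensionalityI[of _ "carrier (obj X i)"])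
    show "diff (shift (shift X k) (- k)) i \<in> extensional (carrier (obj X i))"
      using X'(3) by (simp add: shift_def)
    show "diff X i \<in> extensional (carrier (obj X i))" by (rule X')
    fix x assume x: "x \<in> carrier (obj X i)"
    interpret left_module A "obj X (i + 1)" by (rule X')
    show "diff (shift (shift X k) (- k)) i x = diff X i x"
      using x X'(6)[OF x] by (simp add: shift_simps add.commute[of "- k"])
  qed
  then show ?thesis
    by (simp add: shift_simps cochain.equality ext)
qed

text \<open>Writing the sign as a scalar of \<open>A\<close> allows both parities of
  \<open>k\<close> to be treated at once.\<close>

lemma shift_diff_smult:
  assumes "cochain_complex A X" "x \<in> carrier (obj X (i + k))"
  shows "diff (shift X k) i x =
    (if even k then \<one>\<^bsub>A\<^esub> else \<ominus>\<^bsub>A\<^esub> \<one>\<^bsub>A\<^esub>) \<odot>\<^bsub>obj X (i + k + 1)\<^esub> diff X (i + k) x"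
proof -
  note X' = cochain_complexD[OF assms(1)]
  interpret left_module A "obj X (i + k + 1)" by (rule X')
  show ?thesis
    using assms(2) X'(6)[OF assms(2)] by (simp add: shift_simps smult_minus_one)
qed

text \<open>Linearity of \<open>f\<close> lets the common factor \<open>c\<close> pass through it.
  The reindexed complexes are described only by equations on carriers, so that a sum of two shifts
  is covered as well as a single shift.\<close>

lemma chain_map_reindex:
  assumes f: "f \<in> chain_map A X Y" and c: "c \<in> carrier A"
    and X': "\<And>i. obj X' i = obj X (i + k)"
      "\<And>i x. x \<in> carrier (obj X (i + k)) \<Longrightarrow> diff X' i x = c \<odot>\<^bsub>obj X (i + k + 1)\<^esub> diff X (i + k) x"
    and Y': "\<And>i. obj Y' i = obj Y (i + k)"
      "\<And>i y. y \<in> carrier (obj Y (i + k)) \<Longrightarrow> diff Y' i y = c \<odot>\<^bsub>obj Y (i + k + 1)\<^esub> diff Y (i + k) y"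
    and d: "\<And>i x. x \<in> carrier (obj X i) \<Longrightarrow> diff X i x \<in> carrier (obj X (i + 1))"
  shows "(\<lambda>i. f (i + k)) \<in> chain_map A X' Y'"
proof (rule chain_mapI)
  note f' = chain_mapD[OF f]
  show "f (i + k) \<in> module_hom A (obj X' i) (obj Y' i)" for i
    by (simp add: X' Y' f')
  fix i x assume "x \<in> carrier (obj X' i)"
  then have x: "x \<in> carrier (obj X (i + k))" by (simp add: X')
  have eq: "i + 1 + k = i + k + 1" by simp
  show "f (i + 1 + k) (diff X' i x) = diff Y' i (f (i + k) x)"
    unfolding eq X'(2)[OF x] Y'(2)[OF f'(3)[OF x]]
    using module_homD(3)[OF f'(1) c d[OF x]] f'(2)[OF x] by simp
qed

text \<open>The same mutually inverse maps work after reindexing by \<open>k\<close>, since all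
  differentials involved acquire the same sign.\<close>

lemma complex_iso_shift_sum:
  assumes iso: "complex_iso A X (complex_sum Y W)"
    and X: "cochain_complex A X" and Y: "cochain_complex A Y" and W: "cochain_complex A W"
  shows "complex_iso A (shift X k) (complex_sum (shift Y k) (shift W k))"
proof -
  let ?S = "complex_sum Y W" and ?S' = "complex_sum (shift Y k) (shift W k)"
  define c where "c = (if even k then \<one>\<^bsub>A\<^esub> else \<ominus>\<^bsub>A\<^esub> \<one>\<^bsub>A\<^esub>)"
  \<comment> \<open>Degree 0 is an arbitrary choice: the interpretation serves to make the ring laws
    of \<open>A\<close> available for \<open>c\<close>.\<close>
  interpret left_module A "obj X 0" by (rule cochain_complexD[OF X])
  have c: "c \<in> carrier A"
    by (simp add: c_def)
  have o: "obj ?S' i = obj ?S (i + k)" for i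
    by (simp add: shift_simps)
  have dS': "diff ?S' i z = c \<odot>\<^bsub>obj ?S (i + k + 1)\<^esub> diff ?S (i + k) z"
    if "z \<in> carrier (obj ?S (i + k))" for i z
    using that by (auto simp: shift_simps(1) shift_diff_smult[OF Y] shift_diff_smult[OF W] c_def)
  have dS: "diff ?S i z \<in> carrier (obj ?S (i + 1))" if "z \<in> carrier (obj ?S i)" for i z
    using that cochain_complexD(6)[OF Y] cochain_complexD(6)[OF W] by auto
  have dX: "diff (shift X k) i x = c \<odot>\<^bsub>obj X (i + k + 1)\<^esub> diff X (i + k) x"
    if "x \<in> carrier (obj X (i + k))" for i x
    using shift_diff_smult[OF X that] by (simp add: c_def)
  obtain f g where f: "f \<in> chain_map A X ?S" and g: "g \<in> chain_map A ?S X"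
    and inv: "\<And>i x. x \<in> carrier (obj X i) \<Longrightarrow> g i (f i x) = x"
      "\<And>i y. y \<in> carrier (obj ?S i) \<Longrightarrow> f i (g i y) = y"
    using iso unfolding complex_iso_def by blast
  have f': "(\<lambda>i. f (i + k)) \<in> chain_map A (shift X k) ?S'"
    by (rule chain_map_reindex[OF f c shift_simps(1) dX o dS' cochain_complexD(6)[OF X]])
  have g': "(\<lambda>i. g (i + k)) \<in> chain_map A ?S' (shift X k)"
    by (rule chain_map_reindex[OF g c o dS' shift_simps(1) dX dS])
  have "\<forall>x\<in>carrier (obj (shift X k) i). g (i + k) (f (i + k) x) = x"
    "\<forall>y\<in>carrier (obj ?S' i). f (i + k) (g (i + k) y) = y" for i
    using inv[of _ "i + k"] unfolding o shift_simps(1) by auto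
  then show ?thesis
    unfolding complex_iso_def by (intro bexI[OF _ f'] bexI[OF _ g']) blast
qed

section \<open>Indecomposability in the smaller category and the case distinction\<close>

lemma indecomposable_in_subcategory:
  assumes "indecomposable_in A \<C> Z" "\<C>' \<subseteq> \<C>" "Z \<in> \<C>'"
  shows "indecomposable_in A \<C>' Z"
  using assms unfolding indecomposable_in_def by blast

text \<open>A decomposition of the shifted complex, shifted back, has summands in degrees
  \<open>m' + k\<close> to \<open>n' + k\<close>. By \<open>le\<close> this window lies inside
  \<open>{m..n}\<close>, where \<open>Z\<close> is already known to be indecomposable.\<close>

lemma indecomposable_in_shift:
  fixes Z :: "('a, 'm) cochain"
  assumes ind: "indecomposable_in A (C_proj A m n) Z" and Z: "Z \<in> C_proj A (m' + k) (n' + k)"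
    and le: "m \<le> m' + k" "n' + k \<le> n"
  shows "indecomposable_in A (C_proj A m' n') (shift Z k)"
  unfolding indecomposable_in_def
proof (intro conjI ballI impI)
  show sZ: "shift Z k \<in> C_proj A m' n'"
    using shift_C_proj[OF Z, of k] by simp
  show "\<not> zero_complex (shift Z k)"
    using ind by (simp add: indecomposable_in_def)
  fix Y W :: "('a, 'm) cochain"
  assume Y: "Y \<in> C_proj A m' n'" and W: "W \<in> C_proj A m' n'" and iso: "complex_iso A (shift Z k) (complex_sum Y W)"
  have "complex_iso A (shift (shift Z k) (- k)) (complex_sum (shift Y (- k)) (shift W (- k)))"
    using complex_iso_shift_sum[OF iso] sZ Y W by (simp add: C_projD(1))
  then have "complex_iso A Z (complex_sum (shift Y (- k)) (shift W (- k)))"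
    using shift_shift_inverse[OF C_projD(1)[OF Z]] by simp
  moreover have "shift Y (- k) \<in> C_proj A m n" "shift W (- k) \<in> C_proj A m n"
    using shift_C_proj[OF Y, of "- k"] shift_C_proj[OF W, of "- k"] C_proj_mono[OF le, of A] by auto
  ultimately show "zero_complex Y \<or> zero_complex W"
    using ind unfolding indecomposable_in_def by (metis zero_complex_shift)
qed

text \<open>Common form of the two sides: \<open>j\<close> is the extra degree, and \<open>k\<close>
  is a shift that carries degree \<open>j\<close> to the degree \<open>j - k\<close> inside
  \<open>{1..n'}\<close> while the window \<open>{1 + k..n' + k}\<close> stays inside
  \<open>{m..n}\<close>.\<close>

lemma exists_source_of_enlargement:
  fixes Z :: "('a, 'm) cochain"
  assumes dcc: "submodule_dcc A (regular_module A)" and ind: "indecomposable_in A (C_proj A m n) Z"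
    and deg: "{m..n} \<subseteq> insert j {1..n'}"
    and sub: "m \<le> 1" "n' \<le> n"
    and k: "1 + k \<le> j" "j \<le> n' + k" "m \<le> 1 + k" "n' + k \<le> n"
  shows "\<exists>X :: ('a, 'm) cochain. indecomposable_in A (C_proj A 1 n') X \<and>
    ((\<exists>k. Z = shift X k) \<or> \<not> zero_module (obj Z j) \<and> direct_summand_in A (C_proj A 1 n') X (hard_trunc 1 n' Z))"
proof -
  have Z: "Z \<in> C_proj A m n"
    using ind by (simp add: indecomposable_in_def)
  have cZ: "cochain_complex A Z"
    using C_projD(1)[OF Z] .
  have zero: "zero_module (obj Z i)" if "i \<noteq> j" "i \<notin> {1..n'}" for i
    using C_projD(3)[OF Z, of i] deg that by blast
  consider "zero_module (obj Z j)" | "zero_complex (hard_trunc 1 n' Z)"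
    | "\<not> zero_module (obj Z j)" "\<not> zero_complex (hard_trunc 1 n' Z)"
    by blast
  then show ?thesis
  proof cases
    case 1
    then have "zero_module (obj Z i)" if "i \<notin> {1..n'}" for i
      using zero[of i] that by (cases "i = j") auto
    then have "Z \<in> C_proj A 1 n'"
      using Z by (simp add: C_proj_def)
    then have "indecomposable_in A (C_proj A 1 n') Z"
      using indecomposable_in_subcategory[OF ind C_proj_mono[OF sub]] by blast
    \<comment> \<open>The trivial shift accounts for the case in which \<open>Z\<close> is already
      an object of the smaller category.\<close>
    moreover have "Z = shift Z 0"
      by (simp add: shift_def)
    ultimately show ?thesis
      by blast
  next
    case 2
    have "zero_module (obj Z i)" if "i \<in> {1..n'}" for i
      using 2 that unfolding zero_complex_def by (auto simp: hard_trunc_def dest: spec[of _ i])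
    then have z: "zero_module (obj Z i)" if "i \<noteq> j" for i
      using zero that by blast
    \<comment> \<open>\<open>Z\<close> is concentrated in degree \<open>j\<close>, and the first two
      inequalities of \<open>k\<close> place \<open>j\<close> in this window.\<close>
    have "Z \<in> C_proj A (1 + k) (n' + k)"
      using Z z k(1,2) by (auto simp: C_proj_def)
    then have "indecomposable_in A (C_proj A 1 n') (shift Z k)"
      using indecomposable_in_shift[OF ind] k(3,4) by blast
    moreover have "Z = shift (shift Z k) (- k)"
      using shift_shift_inverse[OF cZ] by simp
    ultimately show ?thesis
      by blast
  next
    case 3
    then show ?thesis
      using exists_indecomposable_summand[OF dcc hard_trunc_C_proj[OF Z]] by blast
  qed
qed

lemma indecomposable_is_shift_or_left_enlargement:
  fixes Z :: "('a, 'm) cochain"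
  assumes dcc: "submodule_dcc A (regular_module A)" and n: "n \<ge> 2"
    and ind: "indecomposable_in A (C_proj A 0 n) Z"
  shows "\<exists>X :: ('a, 'm) cochain. indecomposable_in A (C_proj A 1 n) X \<and>
    ((\<exists>k. Z = shift X k) \<or> left_enlargement A n X Z)"
proof -
  have "{0..n} \<subseteq> insert 0 {1..n}"
    by auto
  \<comment> \<open>As \<open>(Z[-1])^1 = Z^0\<close>, the shift by -1 moves a complex concentrated
    in degree 0 to degree 1.\<close>
  from exists_source_of_enlargement[OF dcc ind this, of "- 1"] n show ?thesis
    using ind by (auto simp: left_enlargement_def)
qed

lemma indecomposable_is_shift_or_right_enlargement:
  fixes Z :: "('a, 'm) cochain"
  assumes dcc: "submodule_dcc A (regular_module A)" and n: "n \<ge> 2"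
    and ind: "indecomposable_in A (C_proj A 1 (n + 1)) Z"
  shows "\<exists>X :: ('a, 'm) cochain. indecomposable_in A (C_proj A 1 n) X \<and>
    ((\<exists>k. Z = shift X k) \<or> right_enlargement A n X Z)"
proof -
  have "{1..n + 1} \<subseteq> insert (n + 1) {1..n}"
    by auto
  \<comment> \<open>As \<open>(Z[1])^n = Z^(n+1)\<close>, the shift by 1 moves a complex
    concentrated in degree \<open>n + 1\<close> to degree \<open>n\<close>.\<close>
  from exists_source_of_enlargement[OF dcc ind this, of 1] n show ?thesis
    using ind by (auto simp: right_enlargement_def)
qed

theorem theorem2p4:
  fixes R :: "('r, 'e) ring_scheme" and A :: "('r, 'a) module" and n :: int
  assumes "artin_algebra R A" and "n \<ge> 2"
  shows "\<forall>Z :: ('a, 'm) cochain.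
    (indecomposable_in A (C_proj A 0 n) Z \<longrightarrow>
      (\<exists>X :: ('a, 'm) cochain. indecomposable_in A (C_proj A 1 n) X \<and>
        ((\<exists>k. Z = shift X k) \<or> left_enlargement A n X Z))) \<and>
    (indecomposable_in A (C_proj A 1 (n + 1)) Z \<longrightarrow>
      (\<exists>X :: ('a, 'm) cochain. indecomposable_in A (C_proj A 1 n) X \<and>
        ((\<exists>k. Z = shift X k) \<or> right_enlargement A n X Z)))"
  using indecomposable_is_shift_or_left_enlargement indecomposable_is_shift_or_right_enlargement
    artin_algebra.submodule_dcc_regular[OF assms(1)] assms(2)
  by blast

end
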